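(* For any $a\in\mathbb R$, let $S_a$ be the shift operator $S_a(\xi,\chi):=(\xi,\chi+a)$. Then: (i) the infinitesimal generator $\frac{d}{da}\big|_{a=0}S_a$ of the one-parameter group $\{S_a:a\in\mathbb R\}$ is the constant map $(\xi,\chi)\mapsto(0,1)$; (ii) the Hamiltonian $\mathcal H$ and its $L^2$-gradient are $S_a$-invariant: $\mathcal H\circ S_a=\mathcal H$, $\nabla\mathcal H\circ S_a=\nabla\mathcal H$; (iii) the vector field $(e^{2\xi},0)$ is the $L^2$-gradient of the drop mass $$\mathcal M(\xi):=\frac12\int_{\mathbb T^1}e^{2\xi}\,d\theta,$$ which is a conserved quantity along the system $\partial_t\xi=e^{-2\xi}\partial_\chi\mathcal H(\xi,\chi)$, $\partial_t\chi=-e^{-2\xi}\partial_\xi\mathcal H(\xi,\chi)$, that is, $\{\mathcal M,\mathcal H\}=0$. Moreover $$\mathcal M\circ S_a=\mathcal M,\qquad\mathcal M\circ\mathcal T_\alpha=\mathcal M,\qquad \nabla\mathcal M\circ S_a=\nabla\mathcal M,\qquad\nabla\mathcal M\circ\mathcal T_\alpha=\mathcal T_\alpha\circ\nabla\mathcal M$$ for all $a\in\mathbb R$ and $\alpha\in\mathbb T^1$.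
   Context: $\sigma_0$ is a constant; $\mathbb T^1=\mathbb R/2\pi\mathbb Z$; $\xi,\chi:\mathbb T^1\to\mathbb R$ are sufficiently smooth; a prime denotes $\partial_\theta$. $(\mathcal T_\alpha(\xi,\chi))(\theta)=(\xi(\theta+\alpha),\chi(\theta+\alpha))$. $\partial_\xi A,\partial_\chi A$ are the $L^2(\mathbb T^1)$-gradients of a functional $A$, $\nabla A=(\partial_\xi A,\partial_\chi A)$, and $\{A,B\}(\xi,\chi)=\langle e^{-2\xi}\partial_\xi A,\partial_\chi B\rangle_{L^2}-\langle e^{-2\xi}\partial_\chi A,\partial_\xi B\rangle_{L^2}$. $\mathcal M$ is regarded as a functional of $(\xi,\chi)$. $$\mathcal H(\xi,\chi)=\frac12\int_{\mathbb T^1}\chi\,G(\xi)\chi\,d\theta+\sigma_0\int_{\mathbb T^1}e^{\xi}\sqrt{1+\xi'^2}\,d\theta-\frac{\sigma_0}2\int_{\mathbb T^1}e^{2\xi}\,d\theta,$$ where $G(\xi)\chi(\theta):=\partial_\rho\tilde\Phi(\xi(\theta),\theta)-\xi'(\theta)\partial_\theta\tilde\Phi(\xi(\theta),\theta)$ and $\tilde\Phi$ solves $\Delta\tilde\Phi=0$ in $\{(\rho,\theta)\in\mathbb R\times\mathbb T^1:\rho<\xi(\theta)\}$, $\tilde\Phi(\xi(\theta),\theta)=\chi(\theta)$, $\partial_\rho\tilde\Phi(\rho,\theta)\to0$ as $\rho\to-\infty$. *)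

theory Defs
  imports "HOL-Analysis.Analysis" "HOL-Library.Extended_Nat"
begin

text \<open>
  A function on the circle \<open>\<real>/2\<pi>\<int>\<close> is a \<open>2\<pi>\<close>-periodic function on the reals. ``Sufficiently smooth''
  means of class \<open>C\<^sup>k\<close> for an arbitrary \<open>k\<close> with \<open>2 \<le> k \<le> \<infinity>\<close>, passed as a parameter; \<open>k = \<infinity>\<close> gives the
  smooth functions. Pairs are ordered as \<open>(\<xi>, \<chi>)\<close>; in formulas \<open>\<chi>\<close>
  is written \<open>chi\<close>, the Greek letter being the binder for Cartesian vectors.
\<close>

type_synonym field = "real \<Rightarrow> real"
type_synonym state = "field \<times> field"
type_synonym functional = "state \<Rightarrow> real"

definition Ck_circle :: "enat \<Rightarrow> field set" where
  "Ck_circle k = {f. (\<forall>\<theta>. f (\<theta> + 2 * pi) = f \<theta>)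
     \<and> (\<forall>j. enat j < k \<longrightarrow> (\<forall>\<theta>. (deriv ^^ j) f differentiable (at \<theta>)))
     \<and> (\<forall>j. enat j \<le> k \<longrightarrow> continuous_on UNIV ((deriv ^^ j) f))}"

definition phase_space :: "enat \<Rightarrow> state set" where
  "phase_space k = Ck_circle k \<times> Ck_circle k"

definition circle_integral :: "field \<Rightarrow> real" where
  "circle_integral f = integral {0..2 * pi} f"

definition L2_inner :: "field \<Rightarrow> field \<Rightarrow> real" where
  "L2_inner f g = circle_integral (\<lambda>\<theta>. f \<theta> * g \<theta>)"

definition translate :: "real \<Rightarrow> state \<Rightarrow> state" where
  "translate \<alpha> = (\<lambda>(\<xi>, chi). (\<lambda>\<theta>. \<xi> (\<theta> + \<alpha>), \<lambda>\<theta>. chi (\<theta> + \<alpha>)))"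

definition shift :: "real \<Rightarrow> state \<Rightarrow> state" where
  "shift a = (\<lambda>(\<xi>, chi). (\<xi>, \<lambda>\<theta>. chi \<theta> + a))"

text \<open>
  Derivative of a curve of functions in the topology of \<open>C\<^sup>k\<close>: the difference quotients converge uniformly
  together with all their \<open>\<theta>\<close>-derivatives up to order \<open>k\<close>.
\<close>

definition has_Ck_derivative :: "enat \<Rightarrow> (real \<Rightarrow> field) \<Rightarrow> field \<Rightarrow> real \<Rightarrow> real set \<Rightarrow> bool" where
  "has_Ck_derivative k c d t I \<longleftrightarrow> (\<forall>j. enat j \<le> k \<longrightarrow>
     uniform_limit UNIV (\<lambda>s. (deriv ^^ j) (\<lambda>\<theta>. (c s \<theta> - c t \<theta>) / (s - t))) ((deriv ^^ j) d) (at t within I))"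

definition has_Ck_state_derivative :: "enat \<Rightarrow> (real \<Rightarrow> state) \<Rightarrow> state \<Rightarrow> real \<Rightarrow> real set \<Rightarrow> bool" where
  "has_Ck_state_derivative k c d t I \<longleftrightarrow>
     has_Ck_derivative k (\<lambda>s. fst (c s)) (fst d) t I \<and> has_Ck_derivative k (\<lambda>s. snd (c s)) (snd d) t I"

text \<open>
  The \<open>L\<^sup>2\<close>-gradient of a functional \<open>F\<close> of one function represents the directional derivatives of \<open>F\<close> along
  all \<open>C\<^sup>k\<close> directions; we take its continuous representative, which is unique.
  Where no gradient exists, \<open>L2_grad\<close> has the value 0.
\<close>

definition has_L2_grad :: "enat \<Rightarrow> (field \<Rightarrow> real) \<Rightarrow> field \<Rightarrow> field \<Rightarrow> bool" where
  "has_L2_grad k F f g \<longleftrightarrow> g \<in> Ck_circle 0 \<and>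
     (\<forall>h \<in> Ck_circle k. ((\<lambda>t. F (\<lambda>\<theta>. f \<theta> + t * h \<theta>)) has_real_derivative L2_inner g h) (at 0))"

definition L2_grad :: "enat \<Rightarrow> (field \<Rightarrow> real) \<Rightarrow> field \<Rightarrow> field" where
  "L2_grad k F f = (if \<exists>g. has_L2_grad k F f g then THE g. has_L2_grad k F f g else (\<lambda>_. 0))"

definition has_gradient :: "enat \<Rightarrow> functional \<Rightarrow> state \<Rightarrow> state \<Rightarrow> bool" where
  "has_gradient k A = (\<lambda>(\<xi>, chi) (p, q).
     has_L2_grad k (\<lambda>\<eta>. A (\<eta>, chi)) \<xi> p \<and> has_L2_grad k (\<lambda>\<eta>. A (\<xi>, \<eta>)) chi q)"

definition grad_xi :: "enat \<Rightarrow> functional \<Rightarrow> state \<Rightarrow> field" where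
  "grad_xi k A = (\<lambda>(\<xi>, chi). L2_grad k (\<lambda>\<eta>. A (\<eta>, chi)) \<xi>)"

definition grad_chi :: "enat \<Rightarrow> functional \<Rightarrow> state \<Rightarrow> field" where
  "grad_chi k A = (\<lambda>(\<xi>, chi). L2_grad k (\<lambda>\<eta>. A (\<xi>, \<eta>)) chi)"

definition gradient :: "enat \<Rightarrow> functional \<Rightarrow> state \<Rightarrow> state" where
  "gradient k A u = (grad_xi k A u, grad_chi k A u)"

definition poisson :: "enat \<Rightarrow> functional \<Rightarrow> functional \<Rightarrow> functional" where
  "poisson k A B u =
     L2_inner (\<lambda>\<theta>. exp (- 2 * fst u \<theta>) * grad_xi k A u \<theta>) (grad_chi k B u)
   - L2_inner (\<lambda>\<theta>. exp (- 2 * fst u \<theta>) * grad_chi k A u \<theta>) (grad_xi k B u)"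

text \<open>
  A solution of the Hamiltonian system of \<open>A\<close> on a time set \<open>I\<close>; both gradients of \<open>A\<close> are required to exist
  along it.
\<close>

definition solves_system :: "enat \<Rightarrow> functional \<Rightarrow> real set \<Rightarrow> (real \<Rightarrow> state) \<Rightarrow> bool" where
  "solves_system k A I u \<longleftrightarrow> (\<forall>t\<in>I. u t \<in> phase_space k \<and>
     (\<exists>p q. has_gradient k A (u t) (p, q) \<and>
        has_Ck_state_derivative 0 u
          (\<lambda>\<theta>. exp (- 2 * fst (u t) \<theta>) * q \<theta>, \<lambda>\<theta>. - exp (- 2 * fst (u t) \<theta>) * p \<theta>) t I))"

definition d_rho :: "(real \<times> real \<Rightarrow> real) \<Rightarrow> real \<times> real \<Rightarrow> real" where
  "d_rho \<Phi> = (\<lambda>(\<rho>, \<theta>). deriv (\<lambda>r. \<Phi> (r, \<theta>)) \<rho>)"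

definition d_theta :: "(real \<times> real \<Rightarrow> real) \<Rightarrow> real \<times> real \<Rightarrow> real" where
  "d_theta \<Phi> = (\<lambda>(\<rho>, \<theta>). deriv (\<lambda>s. \<Phi> (\<rho>, s)) \<theta>)"

definition C1_on :: "(real \<times> real) set \<Rightarrow> (real \<times> real \<Rightarrow> real) \<Rightarrow> bool" where
  "C1_on U \<Phi> \<longleftrightarrow>
     (\<forall>(\<rho>, \<theta>)\<in>U. (\<lambda>r. \<Phi> (r, \<theta>)) differentiable (at \<rho>) \<and> (\<lambda>s. \<Phi> (\<rho>, s)) differentiable (at \<theta>))
     \<and> continuous_on U (d_rho \<Phi>) \<and> continuous_on U (d_theta \<Phi>)"

definition harmonic_on :: "(real \<times> real) set \<Rightarrow> (real \<times> real \<Rightarrow> real) \<Rightarrow> bool" where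
  "harmonic_on U \<Phi> \<longleftrightarrow> C1_on U \<Phi> \<and> C1_on U (d_rho \<Phi>) \<and> C1_on U (d_theta \<Phi>)
     \<and> (\<forall>p\<in>U. d_rho (d_rho \<Phi>) p + d_theta (d_theta \<Phi>) p = 0)"

definition fluid_domain :: "field \<Rightarrow> (real \<times> real) set" where
  "fluid_domain \<xi> = {(\<rho>, \<theta>). \<rho> < \<xi> \<theta>}"

text \<open>
  Classical solutions of the Dirichlet problem, continuously differentiable up to the boundary: the potential
  and its first partial derivatives have limits from inside at every boundary point. The decay of the radial
  derivative is uniform in \<open>\<theta>\<close>; with merely pointwise decay the solution would not be unique.
\<close>

definition harmonic_extension :: "field \<Rightarrow> field \<Rightarrow> (real \<times> real \<Rightarrow> real) \<Rightarrow> bool" where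
  "harmonic_extension \<xi> chi \<Phi> \<longleftrightarrow>
     (\<forall>\<rho> \<theta>. \<Phi> (\<rho>, \<theta> + 2 * pi) = \<Phi> (\<rho>, \<theta>))
   \<and> harmonic_on (fluid_domain \<xi>) \<Phi>
   \<and> (\<forall>\<theta>. (\<Phi> \<longlongrightarrow> chi \<theta>) (at (\<xi> \<theta>, \<theta>) within fluid_domain \<xi>) \<and> \<Phi> (\<xi> \<theta>, \<theta>) = chi \<theta>)
   \<and> (\<forall>\<theta>. \<exists>l. (d_rho \<Phi> \<longlongrightarrow> l) (at (\<xi> \<theta>, \<theta>) within fluid_domain \<xi>))
   \<and> (\<forall>\<theta>. \<exists>l. (d_theta \<Phi> \<longlongrightarrow> l) (at (\<xi> \<theta>, \<theta>) within fluid_domain \<xi>))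
   \<and> uniform_limit UNIV (\<lambda>\<rho> \<theta>. d_rho \<Phi> (\<rho>, \<theta>)) (\<lambda>_. 0) at_bot"

definition boundary_value :: "field \<Rightarrow> (real \<times> real \<Rightarrow> real) \<Rightarrow> field" where
  "boundary_value \<xi> \<Psi> \<theta> = Lim (at (\<xi> \<theta>, \<theta>) within fluid_domain \<xi>) \<Psi>"

text \<open>
  The choice of \<open>\<Phi>\<close> is immaterial, since harmonic extensions agree on the fluid domain. For \<open>\<xi>\<close>, \<open>\<chi>\<close> of class
  \<open>C\<^sup>2\<close> an extension exists by classical potential theory; the value 0 only makes the operator total.
\<close>

definition DN :: "field \<Rightarrow> field \<Rightarrow> field" where
  "DN \<xi> chi = (if \<exists>\<Phi>. harmonic_extension \<xi> chi \<Phi> then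
     (let \<Phi> = (SOME \<Phi>. harmonic_extension \<xi> chi \<Phi>)
      in (\<lambda>\<theta>. boundary_value \<xi> (d_rho \<Phi>) \<theta> - deriv \<xi> \<theta> * boundary_value \<xi> (d_theta \<Phi>) \<theta>))
     else (\<lambda>_. 0))"

definition hamiltonian :: "real \<Rightarrow> functional" where
  "hamiltonian \<sigma>\<^sub>0 = (\<lambda>(\<xi>, chi).
     1 / 2 * circle_integral (\<lambda>\<theta>. chi \<theta> * DN \<xi> chi \<theta>)
   + \<sigma>\<^sub>0 * circle_integral (\<lambda>\<theta>. exp (\<xi> \<theta>) * sqrt (1 + (deriv \<xi> \<theta>)\<^sup>2))
   - \<sigma>\<^sub>0 / 2 * circle_integral (\<lambda>\<theta>. exp (2 * \<xi> \<theta>)))"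

definition mass :: functional where
  "mass = (\<lambda>(\<xi>, chi). 1 / 2 * circle_integral (\<lambda>\<theta>. exp (2 * \<xi> \<theta>)))"

end

theory Submission
  imports Defs
begin

text \<open>
  Adding \<open>a\<close> to \<open>\<chi>\<close> adds \<open>a\<close> to the harmonic extension, which is unique by a maximum principle in the
  half-infinite strip, so \<open>G(\<xi>)(\<chi> + a) = G(\<xi>)\<chi>\<close>. Moreover \<open>\<integral> G(\<xi>)\<chi> d\<theta>\<close> is the flux of \<open>\<nabla>\<Phi>\<close> through
  the free surface; by harmonicity it equals the flux through \<open>\<rho> = -R\<close>, which tends to 0 as \<open>R \<rightarrow> \<infinity>\<close>.
  Together these give the invariance of the Hamiltonian, hence of its gradient. The weight \<open>e\<^sup>-\<^sup>2\<^sup>\<xi>\<close> in the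
  bracket cancels the gradient of the mass, so \<open>{M, H} = \<integral> \<partial>\<^sub>\<chi>H d\<theta>\<close>, the derivative of \<open>H\<close> along the
  shifts, which vanishes.
\<close>


section \<open>Functions on the circle\<close>

text \<open>Two uniqueness statements carry the weight of the definitions: \<open>DN\<close> picks
  an extension by \<open>SOME\<close>, and \<open>L2_grad\<close> is a definite description. For
  gradients, uniqueness is the fundamental lemma of the calculus of variations with test functions
  in \<open>Ck_circle k\<close>, where k = \<infinity> is allowed; trigonometric polynomials serve
  all k at once. States without an extension or a gradient are covered too, since the shift respects
  the default 0 of \<open>DN\<close> and of \<open>L2_grad\<close>. The free surface is the main
  obstacle for the flux: second derivatives of \<Phi> are controlled only in the open fluid domain,
  and the first derivatives merely have limits at the surface. The flux is therefore computed on the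
  lowered curves \<rho> = \<xi>(\<theta>) - s with s > 0, by deforming curves inside the domain, and
  continuity up to the boundary then gives s = 0.\<close>

lemma Ck_circle_periodic: "f \<in> Ck_circle k \<Longrightarrow> f (\<theta> + 2 * pi) = f \<theta>"
  by (simp add: Ck_circle_def)

lemma Ck_circle_continuous: "f \<in> Ck_circle k \<Longrightarrow> continuous_on A f"
proof -
  assume "f \<in> Ck_circle k"
  then have "continuous_on UNIV ((deriv ^^ 0) f)"
    unfolding Ck_circle_def by (metis (no_types, lifting) mem_Collect_eq zero_enat_def zero_le)
  then show ?thesis
    by (auto intro: continuous_on_subset)
qed

lemma Ck_circle_0I: "(\<And>\<theta>. f (\<theta> + 2 * pi) = f \<theta>) \<Longrightarrow> continuous_on UNIV f \<Longrightarrow> f \<in> Ck_circle 0"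
  by (simp add: Ck_circle_def enat_0_iff zero_enat_def)

lemma Ck_circle_C1:
  assumes "f \<in> Ck_circle k" "1 \<le> k"
  shows "(f has_real_derivative deriv f \<theta>) (at \<theta>)" "continuous_on A (deriv f)"
proof -
  have "enat 0 < k"
    using assms(2) by (metis i0_less not_one_le_zero zero_enat_def)
  then have "(deriv ^^ 0) f differentiable (at \<theta>)"
    using assms(1) unfolding Ck_circle_def by blast
  then show "(f has_real_derivative deriv f \<theta>) (at \<theta>)"
    by (simp add: DERIV_deriv_iff_real_differentiable)
  have "enat 1 \<le> k"
    using assms(2) by (simp add: one_enat_def)
  then have "continuous_on UNIV ((deriv ^^ 1) f)"
    using assms(1) unfolding Ck_circle_def by blast
  then show "continuous_on A (deriv f)"
    by (auto intro: continuous_on_subset)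
qed

text \<open>\<open>deriv\<close> is total, with an unspecified value where no derivative exists, so
  linearity at order j needs differentiability at all lower orders.\<close>

lemma higher_deriv_add_cmult:
  fixes f g :: field
  assumes "\<And>i \<theta>. i < j \<Longrightarrow> (deriv ^^ i) f differentiable (at \<theta>)"
    and "\<And>i \<theta>. i < j \<Longrightarrow> (deriv ^^ i) g differentiable (at \<theta>)"
  shows "(deriv ^^ j) (\<lambda>\<theta>. f \<theta> + c * g \<theta>) = (\<lambda>\<theta>. (deriv ^^ j) f \<theta> + c * (deriv ^^ j) g \<theta>)"
  using assms
proof (induction j)
  case (Suc j)
  have "((\<lambda>\<theta>. (deriv ^^ j) f \<theta> + c * (deriv ^^ j) g \<theta>) has_real_derivative
      deriv ((deriv ^^ j) f) x + c * deriv ((deriv ^^ j) g) x) (at x)" for x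
    using Suc.prems[of j x]
    by (auto intro!: DERIV_add DERIV_cmult simp: DERIV_deriv_iff_real_differentiable)
  then have "deriv (\<lambda>\<theta>. (deriv ^^ j) f \<theta> + c * (deriv ^^ j) g \<theta>) = (\<lambda>\<theta>. deriv ((deriv ^^ j) f) \<theta> + c * deriv ((deriv ^^ j) g) \<theta>)"
    by (intro ext DERIV_imp_deriv)
  with Suc show ?case
    by simp
qed simp

lemma higher_deriv_translate:
  fixes f :: field
  assumes "\<And>i \<theta>. i < j \<Longrightarrow> (deriv ^^ i) f differentiable (at \<theta>)"
  shows "(deriv ^^ j) (\<lambda>\<theta>. f (\<theta> + \<alpha>)) = (\<lambda>\<theta>. (deriv ^^ j) f (\<theta> + \<alpha>))"
  using assms
proof (induction j)
  case (Suc j)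
  have "((\<lambda>\<theta>. (deriv ^^ j) f (\<theta> + \<alpha>)) has_real_derivative deriv ((deriv ^^ j) f) (x + \<alpha>)) (at x)" for x
    using Suc.prems[of j "x + \<alpha>"]
    unfolding DERIV_shift[symmetric] by (simp add: DERIV_deriv_iff_real_differentiable)
  then have "deriv (\<lambda>\<theta>. (deriv ^^ j) f (\<theta> + \<alpha>)) = (\<lambda>\<theta>. deriv ((deriv ^^ j) f) (\<theta> + \<alpha>))"
    by (intro ext DERIV_imp_deriv)
  with Suc show ?case
    by simp
qed simp

lemma Ck_circle_add_cmult:
  assumes "f \<in> Ck_circle k" "g \<in> Ck_circle k"
  shows "(\<lambda>\<theta>. f \<theta> + c * g \<theta>) \<in> Ck_circle k"
proof -
  have D: "(deriv ^^ i) f differentiable (at \<theta>)" "(deriv ^^ i) g differentiable (at \<theta>)"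
    if "enat i < k" for i \<theta>
    using assms that unfolding Ck_circle_def by blast+
  have E: "(deriv ^^ j) (\<lambda>\<theta>. f \<theta> + c * g \<theta>) = (\<lambda>\<theta>. (deriv ^^ j) f \<theta> + c * (deriv ^^ j) g \<theta>)"
    if "enat j \<le> k" for j
    using that by (intro higher_deriv_add_cmult D) (meson enat_ord_simps(2) less_le_trans)+
  show ?thesis
    unfolding Ck_circle_def
  proof (intro CollectI conjI allI impI)
    show "f (\<theta> + 2 * pi) + c * g (\<theta> + 2 * pi) = f \<theta> + c * g \<theta>" for \<theta>
      using assms by (simp add: Ck_circle_periodic)
    show "(deriv ^^ j) (\<lambda>\<theta>. f \<theta> + c * g \<theta>) differentiable (at \<theta>)" if "enat j < k" for j \<theta>
      using that by (simp add: E D)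
    show "continuous_on UNIV ((deriv ^^ j) (\<lambda>\<theta>. f \<theta> + c * g \<theta>))" if "enat j \<le> k" for j
      using assms that unfolding E[OF that] Ck_circle_def by (auto intro!: continuous_on_add continuous_on_mult_left)
  qed
qed

lemma Ck_circle_translate:
  assumes "f \<in> Ck_circle k"
  shows "(\<lambda>\<theta>. f (\<theta> + \<alpha>)) \<in> Ck_circle k"
proof -
  have D: "(deriv ^^ i) f differentiable (at \<theta>)" if "enat i < k" for i \<theta>
    using assms that unfolding Ck_circle_def by blast
  have E: "(deriv ^^ j) (\<lambda>\<theta>. f (\<theta> + \<alpha>)) = (\<lambda>\<theta>. (deriv ^^ j) f (\<theta> + \<alpha>))" if "enat j \<le> k" for j
    using that by (intro higher_deriv_translate D) (meson enat_ord_simps(2) less_le_trans)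
  show ?thesis
    unfolding Ck_circle_def
  proof (intro CollectI conjI allI impI)
    show "f (\<theta> + 2 * pi + \<alpha>) = f (\<theta> + \<alpha>)" for \<theta>
      using Ck_circle_periodic[OF assms, of "\<theta> + \<alpha>"] by (simp add: algebra_simps)
    show "(deriv ^^ j) (\<lambda>\<theta>. f (\<theta> + \<alpha>)) differentiable (at \<theta>)" if "enat j < k" for j \<theta>
      using D[OF that, of "\<theta> + \<alpha>"] that
      by (simp add: E real_differentiable_def DERIV_shift)
    show "continuous_on UNIV ((deriv ^^ j) (\<lambda>\<theta>. f (\<theta> + \<alpha>)))" if "enat j \<le> k" for j
    proof -
      have "continuous_on UNIV ((deriv ^^ j) f)"
        using assms that by (simp add: Ck_circle_def)
      then show ?thesis
        unfolding E[OF that] by (rule continuous_on_compose2) (auto intro: continuous_on_add)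
    qed
  qed
qed

section \<open>Trigonometric polynomials as test functions\<close>

text \<open>An algebra of periodic functions closed under differentiation, hence contained in every
  \<open>Ck_circle k\<close>. Closure under products supplies the powers of the peaking
  kernel.\<close>

inductive_set trig_polys :: "field set" where
  const: "(\<lambda>_. c) \<in> trig_polys"
| cos: "cos \<in> trig_polys"
| sin: "sin \<in> trig_polys"
| add: "f \<in> trig_polys \<Longrightarrow> g \<in> trig_polys \<Longrightarrow> (\<lambda>\<theta>. f \<theta> + g \<theta>) \<in> trig_polys"
| mult: "f \<in> trig_polys \<Longrightarrow> g \<in> trig_polys \<Longrightarrow> (\<lambda>\<theta>. f \<theta> * g \<theta>) \<in> trig_polys"

lemma trig_polys_deriv:
  assumes "f \<in> trig_polys"
  shows "\<exists>f'\<in>trig_polys. \<forall>\<theta>. (f has_real_derivative f' \<theta>) (at \<theta>)"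
  using assms
proof induction
  case (const c)
  show ?case by (rule bexI[OF _ trig_polys.const[of 0]]) simp
next
  case cos
  have "(\<lambda>\<theta>. -1 * sin \<theta>) \<in> trig_polys"
    by (intro trig_polys.intros)
  then show ?case
    by (rule bexI[rotated]) (auto intro!: derivative_eq_intros)
next
  case sin
  then show ?case
    by (rule bexI[OF _ trig_polys.cos]) (auto intro!: derivative_eq_intros)
next
  case (add f g)
  then obtain f' g' where "f' \<in> trig_polys" "g' \<in> trig_polys"
    "\<forall>\<theta>. (f has_real_derivative f' \<theta>) (at \<theta>)" "\<forall>\<theta>. (g has_real_derivative g' \<theta>) (at \<theta>)"
    by blast
  then show ?case
    by (intro bexI[of _ "\<lambda>\<theta>. f' \<theta> + g' \<theta>"]) (simp_all add: DERIV_add trig_polys.add)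
next
  case (mult f g)
  then obtain f' g' where "f' \<in> trig_polys" "g' \<in> trig_polys"
    "\<forall>\<theta>. (f has_real_derivative f' \<theta>) (at \<theta>)" "\<forall>\<theta>. (g has_real_derivative g' \<theta>) (at \<theta>)"
    by blast
  with mult.hyps show ?case
    by (intro bexI[of _ "\<lambda>\<theta>. f' \<theta> * g \<theta> + f \<theta> * g' \<theta>"])
       (auto intro!: derivative_eq_intros simp: trig_polys.add trig_polys.mult)
qed

lemma trig_polys_higher_deriv:
  assumes "f \<in> trig_polys"
  shows "(deriv ^^ j) f \<in> trig_polys"
proof (induction j)
  case (Suc j)
  obtain f' where "f' \<in> trig_polys" "\<forall>\<theta>. ((deriv ^^ j) f has_real_derivative f' \<theta>) (at \<theta>)"
    using trig_polys_deriv[OF Suc] by blast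
  moreover from this have "deriv ((deriv ^^ j) f) = f'"
    by (auto intro: DERIV_imp_deriv)
  ultimately show ?case by simp
qed (use assms in simp)

lemma trig_polys_periodic: "f \<in> trig_polys \<Longrightarrow> f (\<theta> + 2 * pi) = f \<theta>"
  by (induction rule: trig_polys.induct) auto

lemma trig_polys_Ck_circle: "f \<in> trig_polys \<Longrightarrow> f \<in> Ck_circle k"
proof -
  assume f: "f \<in> trig_polys"
  have "(deriv ^^ j) f differentiable (at \<theta>)" for j \<theta>
    using trig_polys_deriv[OF trig_polys_higher_deriv[OF f, of j]] real_differentiable_def by blast
  then show ?thesis
    using trig_polys_periodic[OF f]
    by (auto simp: Ck_circle_def intro!: differentiable_imp_continuous_on simp: differentiable_on_def)
qed

lemma trig_polys_power: "f \<in> trig_polys \<Longrightarrow> (\<lambda>\<theta>. f \<theta> ^ n) \<in> trig_polys"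
  by (induction n) (simp_all add: trig_polys.const trig_polys.mult)

lemma const_Ck_circle: "(\<lambda>_. c) \<in> Ck_circle k"
  by (simp add: trig_polys.const trig_polys_Ck_circle)

text \<open>For an antiderivative F, the difference F(x + 2 pi) - F(x) has derivative f(x + 2 pi) -
  f(x) = 0. Its values at x = \<alpha> and x = 0 are the two integrals.\<close>

lemma circle_integral_translate:
  assumes per: "\<And>\<theta>. f (\<theta> + 2 * pi) = f \<theta>" and cont: "continuous_on UNIV f"
  shows "circle_integral (\<lambda>\<theta>. f (\<theta> + \<alpha>)) = circle_integral f"
proof -
  \<comment> \<open>Large enough that x and x + 2 pi lie strictly inside (-K, K) whenever |x| \<le>
    |\<alpha>|; there F has a two-sided derivative.\<close>
  define K where "K = \<bar>\<alpha>\<bar> + 2 * pi + 1"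
  define F where "F x = integral {-K..x} f" for x
  have F: "(F has_real_derivative f x) (at x)" if "-K < x" "x < K" for x
  proof -
    have "(F has_real_derivative f x) (at x within {-K..K})"
      unfolding F_def
      using that by (intro integral_has_real_derivative continuous_on_subset[OF cont]) auto
    moreover have "at x within {-K..K} = at x"
      using that by (intro at_within_interior) auto
    ultimately show ?thesis by simp
  qed
  have I: "integral {x..x + 2 * pi} f = F (x + 2 * pi) - F x" if "\<bar>x\<bar> \<le> \<bar>\<alpha>\<bar>" for x
  proof (intro integral_unique fundamental_theorem_of_calculus)
    show "x \<le> x + 2 * pi" by simp
    show "(F has_vector_derivative f y) (at y within {x..x + 2 * pi})" if "y \<in> {x..x + 2 * pi}" for y
    proof -
      have "- K < y" "y < K"
        using that \<open>\<bar>x\<bar> \<le> \<bar>\<alpha>\<bar>\<close> pi_gt_zero unfolding K_def atLeastAtMost_iff by linarith+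
      then show ?thesis
        unfolding has_real_derivative_iff_has_vector_derivative[symmetric]
        by (rule has_field_derivative_at_within[OF F])
    qed
  qed
  have "\<exists>c. \<forall>x\<in>{-\<bar>\<alpha>\<bar>..\<bar>\<alpha>\<bar>}. F (x + 2 * pi) - F x = c"
  proof (rule has_field_derivative_zero_constant)
    fix x assume x: "x \<in> {-\<bar>\<alpha>\<bar>..\<bar>\<alpha>\<bar>}"
    have "- K < x" "x < K" "- K < x + 2 * pi" "x + 2 * pi < K"
      using x pi_gt_zero unfolding K_def atLeastAtMost_iff by linarith+
    then have "(F has_real_derivative f x) (at (x + 2 * pi))" "(F has_real_derivative f x) (at x)"
      using F[of "x + 2 * pi"] F[of x] by (simp_all add: per)
    then have "((\<lambda>x. F (x + 2 * pi) - F x) has_real_derivative 0) (at x)"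
      unfolding DERIV_shift by (rule DERIV_diff[THEN DERIV_cong]) simp
    then show "((\<lambda>x. F (x + 2 * pi) - F x) has_real_derivative 0) (at x within {-\<bar>\<alpha>\<bar>..\<bar>\<alpha>\<bar>})"
      by (rule has_field_derivative_at_within)
  qed simp
  then obtain b where "\<And>x. \<bar>x\<bar> \<le> \<bar>\<alpha>\<bar> \<Longrightarrow> F (x + 2 * pi) - F x = b"
    by (auto simp: abs_le_iff)
  then have "integral {\<alpha>..\<alpha> + 2 * pi} f = integral {0..0 + 2 * pi} f"
    by (metis I abs_ge_zero abs_zero order_refl)
  moreover have "integral {0..2 * pi} (\<lambda>\<theta>. f (\<theta> + \<alpha>)) = integral {\<alpha>..\<alpha> + 2 * pi} f"
    using integral_shift_Icc_real[of 0 "2 * pi" f \<alpha>] by (simp add: o_def add.commute)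
  ultimately show ?thesis
    by (simp add: circle_integral_def)
qed

text \<open>
  Testing against the powers of \<open>(1 + cos (\<theta> - \<theta>\<^sub>0)) / 2\<close>, which concentrate at \<open>\<theta>\<^sub>0\<close>;
  the translation moves the peak to the midpoint \<open>\<pi>\<close> of the interval of integration.
\<close>

lemma circle_orthogonal_nonpos:
  assumes per: "\<And>\<theta>. f (\<theta> + 2 * pi) = f \<theta>" and cont: "continuous_on UNIV f"
    and orth: "\<And>h. h \<in> Ck_circle k \<Longrightarrow> L2_inner f h = 0"
  shows "f \<theta>\<^sub>0 \<le> 0"
proof (rule ccontr)
  assume "\<not> f \<theta>\<^sub>0 \<le> 0"
  define F where "F = (\<lambda>\<theta>. f (\<theta> + (\<theta>\<^sub>0 - pi)))"
  define c where "c = F pi / 2"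
  \<comment> \<open>The absolute value puts the argument of \<open>cos\<close> into [0, pi] on the
    interval of integration, where \<open>cos\<close> is decreasing.\<close>
  define s :: field where "s = (\<lambda>\<theta>. (1 + cos \<bar>\<theta> - pi\<bar>) / 2)"
  have c: "0 < c" "c < F pi"
    using \<open>\<not> f \<theta>\<^sub>0 \<le> 0\<close> by (auto simp: c_def F_def)
  have contF: "continuous_on A F" for A
    unfolding F_def by (intro continuous_on_compose2[OF cont] continuous_intros) auto
  have conts: "continuous_on A s" for A
    unfolding s_def by (intro continuous_intros) auto
  have s01: "0 \<le> s \<theta>" "s \<theta> \<le> 1" for \<theta>
    using cos_ge_minus_one[of "\<bar>\<theta> - pi\<bar>"] cos_le_one[of "\<bar>\<theta> - pi\<bar>"] by (simp_all add: s_def)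
  have int0: "integral {0..2 * pi} (\<lambda>\<theta>. F \<theta> * s \<theta> ^ n) = 0" for n
  proof -
    \<comment> \<open>The addition theorem for \<open>cos (\<theta> - \<theta>\<^sub>0)\<close>
      exhibits the kernel as a trigonometric polynomial.\<close>
    define h where "h = (\<lambda>\<theta>. (1/2 + (cos \<theta>\<^sub>0 / 2 * cos \<theta> + sin \<theta>\<^sub>0 / 2 * sin \<theta>)) ^ n)"
    have h: "h \<in> trig_polys"
      unfolding h_def by (intro trig_polys_power trig_polys.intros)
    have hs: "h (\<theta> + (\<theta>\<^sub>0 - pi)) = s \<theta> ^ n" for \<theta>
    proof -
      have "cos \<bar>\<theta> - pi\<bar> = cos (\<theta> + (\<theta>\<^sub>0 - pi) - \<theta>\<^sub>0)"
        by (auto simp: abs_if cos_diff)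
      also have "\<dots> = cos \<theta>\<^sub>0 * cos (\<theta> + (\<theta>\<^sub>0 - pi)) + sin \<theta>\<^sub>0 * sin (\<theta> + (\<theta>\<^sub>0 - pi))"
        by (subst cos_diff) (simp add: mult.commute)
      finally have eq: "cos \<bar>\<theta> - pi\<bar> = cos \<theta>\<^sub>0 * cos (\<theta> + (\<theta>\<^sub>0 - pi)) + sin \<theta>\<^sub>0 * sin (\<theta> + (\<theta>\<^sub>0 - pi))" .
      have "s \<theta> = 1/2 + (cos \<theta>\<^sub>0 / 2 * cos (\<theta> + (\<theta>\<^sub>0 - pi)) + sin \<theta>\<^sub>0 / 2 * sin (\<theta> + (\<theta>\<^sub>0 - pi)))"
        unfolding s_def eq by (simp only: add_divide_distrib times_divide_eq_left)
      then show ?thesis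
        by (simp only: h_def)
    qed
    have "0 = circle_integral (\<lambda>\<theta>. f \<theta> * h \<theta>)"
      using orth[OF trig_polys_Ck_circle[OF h]] by (simp add: L2_inner_def)
    also have "\<dots> = circle_integral (\<lambda>\<theta>. f (\<theta> + (\<theta>\<^sub>0 - pi)) * h (\<theta> + (\<theta>\<^sub>0 - pi)))"
      using Ck_circle_continuous[OF trig_polys_Ck_circle[OF h]]
      by (subst circle_integral_translate[where f = "\<lambda>\<theta>. f \<theta> * h \<theta>"])
         (auto simp: per trig_polys_periodic[OF h] intro!: continuous_intros cont)
    finally show ?thesis
      by (simp add: circle_integral_def F_def hs)
  qed
  have "isCont F pi"
    using contF[of UNIV] by (simp add: continuous_on_eq_continuous_at)
  then obtain d where d: "0 < d" "\<And>x. \<bar>x - pi\<bar> < d \<Longrightarrow> \<bar>F x - F pi\<bar> < F pi - c"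
    using c(2) unfolding continuous_at_eps_delta dist_real_def by (meson diff_gt_0_iff_gt)
  \<comment> \<open>Halving d gives the strict \<delta> < d, so the lower bound c for F holds up to
    distance \<delta> inclusive; the cap pi keeps the window inside [0, 2 pi].\<close>
  define \<delta> where "\<delta> = min (d / 2) pi"
  have \<delta>: "0 < \<delta>" "\<delta> \<le> pi" "\<delta> < d"
    using d(1) by (auto simp: \<delta>_def)
  have Fc: "c \<le> F x" if "\<bar>x - pi\<bar> \<le> \<delta>" for x
    using d(2)[of x] that \<delta>(3) by linarith
  \<comment> \<open>Outside the \<delta>-window s \<le> q, inside the window of half the size s
    \<ge> r. The strict gap q < r makes \<open>(q / r) ^ n\<close> tend to 0.\<close>
  define q where "q = (1 + cos \<delta>) / 2"
  define r where "r = (1 + cos (\<delta> / 2)) / 2"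
  have "cos \<delta> < cos (\<delta> / 2)"
    using \<delta> by (intro cos_monotone_0_pi) auto
  then have qr: "0 \<le> q" "q < r"
    using s01(1)[of "\<delta> + pi"] \<delta>(1) by (simp_all add: q_def r_def s_def)
  obtain M where M: "\<And>x. x \<in> {0..2 * pi} \<Longrightarrow> \<bar>F x\<bar> \<le> M"
    using compact_imp_bounded[OF compact_continuous_image[OF contF compact_Icc]]
    unfolding bounded_iff by (metis image_eqI real_norm_def)
  have M0: "0 \<le> M"
    using M[of 0] by force
  \<comment> \<open>The correction \<open>M * q ^ n\<close> absorbs negative values of F away from
    the peak. The integrand is then nonnegative, so restricting it to the smaller window can only
    lower the integral.\<close>
  have nonneg: "0 \<le> F x * s x ^ n + M * q ^ n" if "x \<in> {0..2 * pi}" for x n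
  proof (cases "\<bar>x - pi\<bar> \<le> \<delta>")
    case True
    then show ?thesis
      using Fc[OF True] c(1) s01[of x] M0 qr(1) by (intro add_nonneg_nonneg mult_nonneg_nonneg) auto
  next
    case False
    have "\<bar>x - pi\<bar> \<le> pi"
      using that by (simp add: abs_le_iff)
    with False \<delta>(1) have "cos \<bar>x - pi\<bar> \<le> cos \<delta>"
      by (intro cos_monotone_0_pi_le) linarith+
    then have "s x \<le> q"
      unfolding s_def q_def by (intro divide_right_mono add_left_mono) simp_all
    then have "\<bar>F x * s x ^ n\<bar> \<le> M * q ^ n"
      unfolding abs_mult using M[OF that] s01[of x] M0
      by (intro mult_mono) (auto simp: power_abs intro!: power_mono)
    then show ?thesis by linarith
  qed
  have bound: "\<delta> * c * r ^ n \<le> 2 * pi * M * q ^ n" for n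
  proof -
    have cont1: "continuous_on A (\<lambda>x. F x * s x ^ n + M * q ^ n)" for A
      by (intro continuous_intros contF conts)
    have "\<delta> * c * r ^ n = integral {pi - \<delta> / 2..pi + \<delta> / 2} (\<lambda>x. c * r ^ n)"
      using \<delta> by simp
    also have "\<dots> \<le> integral {pi - \<delta> / 2..pi + \<delta> / 2} (\<lambda>x. F x * s x ^ n + M * q ^ n)"
    proof (intro integral_le integrable_continuous_real continuous_intros cont1)
      fix x assume x: "x \<in> {pi - \<delta> / 2..pi + \<delta> / 2}"
      then have ax: "\<bar>x - pi\<bar> \<le> \<delta> / 2"
        unfolding abs_le_iff by auto
      with \<delta> have "cos (\<delta> / 2) \<le> cos \<bar>x - pi\<bar>"
        by (intro cos_monotone_0_pi_le) linarith+
      then have "r \<le> s x"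
        unfolding s_def r_def by (intro divide_right_mono add_left_mono) simp_all
      then have "c * r ^ n \<le> F x * s x ^ n"
        using Fc[of x] ax \<delta>(1) c(1) qr
        by (intro mult_mono power_mono) auto
      moreover have "0 \<le> M * q ^ n"
        using M0 qr(1) by simp
      ultimately show "c * r ^ n \<le> F x * s x ^ n + M * q ^ n"
        by linarith
    qed (rule contF conts)+
    also have "\<dots> \<le> integral {0..2 * pi} (\<lambda>x. F x * s x ^ n + M * q ^ n)"
      using \<delta> nonneg by (intro integral_subset_le integrable_continuous_real cont1) auto
    also have "\<dots> = integral {0..2 * pi} (\<lambda>x. F x * s x ^ n) + integral {0..2 * pi} (\<lambda>x. M * q ^ n)"
      by (intro Henstock_Kurzweil_Integration.integral_add integrable_continuous_real continuous_intros contF conts)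
    finally show ?thesis
      unfolding int0 by (simp add: mult_ac)
  qed
  have "(\<lambda>n. 2 * pi * M * (q / r) ^ n) \<longlonglongrightarrow> 2 * pi * M * 0"
    using qr by (intro tendsto_mult tendsto_const LIMSEQ_power_zero) auto
  moreover have "\<delta> * c \<le> 2 * pi * M * (q / r) ^ n" for n
    using bound[of n] qr by (simp add: power_divide field_simps)
  ultimately have "\<delta> * c \<le> 2 * pi * M * 0"
    by (intro LIMSEQ_le_const) auto
  then show False
    using \<delta>(1) c(1) by (simp add: mult_le_0_iff)
qed

lemma circle_orthogonal_imp_zero:
  assumes per: "\<And>\<theta>. f (\<theta> + 2 * pi) = f \<theta>" and cont: "continuous_on UNIV f"
    and orth: "\<And>h. h \<in> Ck_circle k \<Longrightarrow> L2_inner f h = 0"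
  shows "f = (\<lambda>_. 0)"
proof
  fix \<theta>
  have "f \<theta> \<le> 0"
    using assms by (rule circle_orthogonal_nonpos)
  moreover have "- f \<theta> \<le> 0"
  proof (rule circle_orthogonal_nonpos[where f = "\<lambda>\<theta>. - f \<theta>" and k = k])
    show "L2_inner (\<lambda>\<theta>. - f \<theta>) h = 0" if "h \<in> Ck_circle k" for h
      using orth[OF that] by (simp add: L2_inner_def circle_integral_def)
  qed (simp_all add: per continuous_on_minus cont)
  ultimately show "f \<theta> = 0" by simp
qed

section \<open>Gradients\<close>

text \<open>The difference of two gradients is continuous and orthogonal to all test functions,
  hence zero. This gives meaning to the \<open>THE\<close> in \<open>L2_grad\<close>.\<close>

lemma has_L2_grad_unique:
  assumes "has_L2_grad k F f g" "has_L2_grad k F f g'"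
  shows "g = g'"
proof -
  have g: "g \<in> Ck_circle 0" "g' \<in> Ck_circle 0"
    using assms by (auto simp: has_L2_grad_def)
  note cont = g[THEN Ck_circle_continuous]
  have "(\<lambda>\<theta>. g \<theta> - g' \<theta>) = (\<lambda>_. 0)"
  proof (rule circle_orthogonal_imp_zero[where k = k])
    fix h assume h: "h \<in> Ck_circle k"
    have "L2_inner g h = L2_inner g' h"
      using assms h unfolding has_L2_grad_def by (blast intro: DERIV_unique)
    moreover have "L2_inner (\<lambda>\<theta>. g \<theta> - g' \<theta>) h = L2_inner g h - L2_inner g' h"
      unfolding L2_inner_def circle_integral_def left_diff_distrib
      by (intro integral_diff integrable_continuous_real continuous_intros cont Ck_circle_continuous[OF h])
    ultimately show "L2_inner (\<lambda>\<theta>. g \<theta> - g' \<theta>) h = 0"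
      by simp
  qed (auto intro!: continuous_intros cont simp: g Ck_circle_periodic[OF g(1)] Ck_circle_periodic[OF g(2)])
  then show ?thesis
    by (simp add: fun_eq_iff)
qed

lemma L2_grad_eq: "has_L2_grad k F f g \<Longrightarrow> L2_grad k F f = g"
  unfolding L2_grad_def using has_L2_grad_unique by (metis the_equality)

lemma gradient_eq: "has_gradient k A u g \<Longrightarrow> gradient k A u = g"
  by (auto simp: has_gradient_def gradient_def grad_xi_def grad_chi_def split_beta L2_grad_eq)

text \<open>A gradient sees F only on the lines f + t h with h in \<open>Ck_circle k\<close>, so
  invariance on the phase space is enough. Equality of the predicates, rather than of
  \<open>L2_grad\<close>, also transfers existence.\<close>

lemma has_L2_grad_cong:
  assumes "\<And>t h. h \<in> Ck_circle k \<Longrightarrow> F (\<lambda>\<theta>. f \<theta> + t * h \<theta>) = F' (\<lambda>\<theta>. f' \<theta> + t * h \<theta>)"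
  shows "has_L2_grad k F f = has_L2_grad k F' f'"
  using assms unfolding has_L2_grad_def by (intro ext) simp

lemma L2_grad_cong: "has_L2_grad k F f = has_L2_grad k F' f' \<Longrightarrow> L2_grad k F f = L2_grad k F' f'"
  by (simp add: L2_grad_def)

section \<open>Differentiating the mass along a curve\<close>

text \<open>Serves both the gradient of the mass, on straight lines, and its time derivative, on
  solution curves that are differentiable only in the uniform norm. With Q the difference quotient
  of c and \<phi>(x) = (exp x - 1) / x, the quotient of the exponentials is
  \<open>exp (2 * c t \<theta>)\<close> times 2 Q \<phi>(2 (s - t) Q), and every factor converges
  uniformly.\<close>

lemma has_real_derivative_circle_integral_exp:
  assumes d: "continuous_on UNIV d" and c: "\<And>s. s \<in> I \<Longrightarrow> continuous_on UNIV (c s)" and "t \<in> I"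
    and lim: "uniform_limit UNIV (\<lambda>s \<theta>. (c s \<theta> - c t \<theta>) / (s - t)) d (at t within I)"
  shows "((\<lambda>s. 1 / 2 * circle_integral (\<lambda>\<theta>. exp (2 * c s \<theta>))) has_real_derivative
    L2_inner (\<lambda>\<theta>. exp (2 * c t \<theta>)) d) (at t within I)"
proof (cases "at t within I = bot")
  \<comment> \<open>If t is isolated in I, the derivative holds vacuously; passing to the limit
    under the integral requires a nontrivial filter.\<close>
  case True
  then show ?thesis by (simp add: has_field_derivative_iff)
next
  case False
  define S where "S = {0..2 * pi}"
  define Q where "Q = (\<lambda>s \<theta>. (c s \<theta> - c t \<theta>) / (s - t))"
  \<comment> \<open>Filling the removable singularity with 1 makes \<phi> continuous at 0, which
    covers the points where the difference quotient vanishes.\<close>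
  define \<phi> :: field where "\<phi> = (\<lambda>x. if x = 0 then 1 else (exp x - 1) / x)"
  \<comment> \<open>Off I nothing is known about \<open>c s\<close>, yet the integrals
    \<open>J s\<close> are wanted for every s; the value 0 keeps \<open>E s\<close> continuous
    there. At s = t division by zero gives 0 as well.\<close>
  define E where "E = (\<lambda>s \<theta>. if s \<in> I then (exp (2 * c s \<theta>) - exp (2 * c t \<theta>)) / (s - t) else 0)"
  note ct = c[OF \<open>t \<in> I\<close>]
  have bounded: "bounded (f ` S)" if "continuous_on UNIV f" for f :: field
    unfolding S_def
    by (intro compact_imp_bounded compact_continuous_image continuous_on_subset[OF that]) auto
  have "((\<lambda>x::real. (exp x - 1) / x) \<longlongrightarrow> 1) (at 0)"
    using DERIV_exp[of "0::real"] by (simp add: DERIV_def)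
  then have "(\<phi> \<longlongrightarrow> 1) (at 0)"
    by (rule Lim_transform_eventually) (auto simp: \<phi>_def eventually_at_filter)
  moreover have \<phi>0: "\<phi> 0 = 1"
    by (simp add: \<phi>_def)
  ultimately have \<phi>: "isCont \<phi> 0"
    by (simp add: isCont_def)
  have Q: "uniform_limit S Q d (at t within I)"
    using lim unfolding Q_def by (rule uniform_limit_on_subset) simp
  have "((\<lambda>s. 2 * (s - t)) \<longlongrightarrow> 2 * (t - t)) (at t within I)"
    by (intro tendsto_intros)
  then have "uniform_limit S (\<lambda>s \<theta>. 2 * (s - t)) (\<lambda>\<theta>. 0) (at t within I)"
    by (auto simp: uniform_limit_iff tendsto_iff)
  from uniform_lim_mult[OF this Q] bounded[OF d]
  have small: "uniform_limit S (\<lambda>s \<theta>. 2 * (s - t) * Q s \<theta>) (\<lambda>\<theta>. 0) (at t within I)"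
    by (force simp: image_constant_conv)
  have "uniform_limit S (\<lambda>s \<theta>. \<phi> (2 * (s - t) * Q s \<theta>)) (\<lambda>\<theta>. 1) (at t within I)"
  proof (rule uniform_limitI)
    fix e :: real assume "0 < e"
    then obtain \<delta> where \<delta>: "0 < \<delta>" "\<And>x. dist x 0 < \<delta> \<Longrightarrow> dist (\<phi> x) (\<phi> 0) < e"
      using \<phi> unfolding continuous_at_eps_delta by blast
    show "\<forall>\<^sub>F s in at t within I. \<forall>\<theta>\<in>S. dist (\<phi> (2 * (s - t) * Q s \<theta>)) 1 < e"
      using uniform_limitD[OF small \<delta>(1)]
      by eventually_elim (metis \<delta>(2) \<phi>0)
  qed
  then have "uniform_limit S (\<lambda>s \<theta>. exp (2 * c t \<theta>) * (2 * (Q s \<theta> * \<phi> (2 * (s - t) * Q s \<theta>))))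
      (\<lambda>\<theta>. exp (2 * c t \<theta>) * (2 * (d \<theta> * 1))) (at t within I)"
    by (intro uniform_lim_mult uniform_limit_const Q bounded continuous_intros d ct)
       (auto intro!: bounded continuous_intros d)
  then have "uniform_limit S E (\<lambda>\<theta>. exp (2 * c t \<theta>) * (2 * (d \<theta> * 1))) (at t within I)"
  proof (rule uniform_limit_cong[THEN iffD1, rotated 2])
    have "E s \<theta> = exp (2 * c t \<theta>) * (2 * (Q s \<theta> * \<phi> (2 * (s - t) * Q s \<theta>)))"
      if "s \<in> I" "s \<noteq> t" for s \<theta>
    proof (cases "c s \<theta> = c t \<theta>")
      case True
      then show ?thesis
        by (simp add: E_def Q_def)
    next
      case False
      have arg: "2 * (s - t) * Q s \<theta> = 2 * c s \<theta> - 2 * c t \<theta>"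
        using that by (simp add: Q_def field_simps)
      show ?thesis
        unfolding arg using that False by (simp add: E_def Q_def \<phi>_def exp_diff divide_simps)
    qed
    then show "\<forall>\<^sub>F s in at t within I. \<forall>\<theta>\<in>S.
        exp (2 * c t \<theta>) * (2 * (Q s \<theta> * \<phi> (2 * (s - t) * Q s \<theta>))) = E s \<theta>"
      by (auto simp: eventually_at_filter)
  qed simp
  then obtain J L where J: "\<And>s. (E s has_integral J s) S"
    and L: "((\<lambda>\<theta>. exp (2 * c t \<theta>) * (2 * (d \<theta> * 1))) has_integral L) S" and JL: "(J \<longlongrightarrow> L) (at t within I)"
  proof (rule uniform_limit_integral[where a = 0 and b = "2 * pi", folded S_def])
    show "continuous_on S (E s)" for s
    proof (cases "s \<in> I")
      case True
      then show ?thesis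
        unfolding E_def
        by (cases "s = t")
           (auto intro!: continuous_intros continuous_on_subset[OF c[OF True]] continuous_on_subset[OF ct])
    qed (simp add: E_def)
  qed (use False in auto)
  have "L = 2 * L2_inner (\<lambda>\<theta>. exp (2 * c t \<theta>)) d"
    using integral_unique[OF L]
    by (simp add: L2_inner_def circle_integral_def S_def mult.left_commute[of _ 2])
  moreover have "(1 / 2 * circle_integral (\<lambda>\<theta>. exp (2 * c s \<theta>)) - 1 / 2 * circle_integral (\<lambda>\<theta>. exp (2 * c t \<theta>))) / (s - t)
      = 1 / 2 * J s" if "s \<in> I" for s
  proof -
    have "integral S (\<lambda>\<theta>. exp (2 * c s \<theta>) - exp (2 * c t \<theta>)) =
        integral S (\<lambda>\<theta>. exp (2 * c s \<theta>)) - integral S (\<lambda>\<theta>. exp (2 * c t \<theta>))"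
      unfolding S_def
      by (intro integral_diff integrable_continuous_real continuous_intros
          continuous_on_subset[OF c[OF that]] continuous_on_subset[OF ct]) auto
    then have "J s = (circle_integral (\<lambda>\<theta>. exp (2 * c s \<theta>)) - circle_integral (\<lambda>\<theta>. exp (2 * c t \<theta>))) / (s - t)"
      using integral_unique[OF J[of s]] that by (simp add: E_def circle_integral_def S_def)
    then show ?thesis
      by (simp add: diff_divide_distrib right_diff_distrib)
  qed
  then have "\<forall>\<^sub>F s in at t within I. 1 / 2 * J s =
    (1 / 2 * circle_integral (\<lambda>\<theta>. exp (2 * c s \<theta>)) - 1 / 2 * circle_integral (\<lambda>\<theta>. exp (2 * c t \<theta>))) / (s - t)"
    by (auto simp: eventually_at_filter)
  ultimately show ?thesis
    using Lim_transform_eventually[OF tendsto_mult_left[OF JL, of "1 / 2"]]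
    unfolding has_field_derivative_iff by simp
qed

lemma mass_has_gradient:
  assumes "\<xi> \<in> Ck_circle k"
  shows "has_gradient k mass (\<xi>, chi) (\<lambda>\<theta>. exp (2 * \<xi> \<theta>), \<lambda>_. 0)"
  unfolding has_gradient_def prod.case
proof
  note cont = Ck_circle_continuous[OF assms]
  show "has_L2_grad k (\<lambda>\<eta>. mass (\<eta>, chi)) \<xi> (\<lambda>\<theta>. exp (2 * \<xi> \<theta>))"
    unfolding has_L2_grad_def
  proof (intro conjI ballI)
    show "(\<lambda>\<theta>. exp (2 * \<xi> \<theta>)) \<in> Ck_circle 0"
      by (intro Ck_circle_0I continuous_intros cont) (simp add: Ck_circle_periodic[OF assms])
    fix h assume h: "h \<in> Ck_circle k"
    show "((\<lambda>t. mass (\<lambda>\<theta>. \<xi> \<theta> + t * h \<theta>, chi)) has_real_derivative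
        L2_inner (\<lambda>\<theta>. exp (2 * \<xi> \<theta>)) h) (at 0)"
    proof -
      have "((\<lambda>t. 1 / 2 * circle_integral (\<lambda>\<theta>. exp (2 * (\<xi> \<theta> + t * h \<theta>)))) has_real_derivative
          L2_inner (\<lambda>\<theta>. exp (2 * (\<xi> \<theta> + 0 * h \<theta>))) h) (at 0)"
      proof (rule has_real_derivative_circle_integral_exp[where I = UNIV])
        \<comment> \<open>Along a straight line the quotient equals h for every s \<noteq>
          0.\<close>
        show "uniform_limit UNIV (\<lambda>s \<theta>. (\<xi> \<theta> + s * h \<theta> - (\<xi> \<theta> + 0 * h \<theta>)) / (s - 0)) h (at 0)"
          by (rule uniform_limitI) (auto simp: eventually_at_filter)
      qed (auto intro!: continuous_on_add continuous_on_mult_left cont Ck_circle_continuous[OF h])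
      then show ?thesis
        by (simp add: mass_def)
    qed
  qed
  show "has_L2_grad k (\<lambda>\<eta>. mass (\<xi>, \<eta>)) chi (\<lambda>_. 0)"
    by (simp add: has_L2_grad_def mass_def const_Ck_circle L2_inner_def circle_integral_def)
qed

section \<open>Conservation of the mass\<close>

lemma solves_system_imp_deriv:
  assumes "solves_system k A I u" "t \<in> I"
  obtains q where "has_L2_grad k (\<lambda>\<eta>. A (fst (u t), \<eta>)) (snd (u t)) q"
    and "uniform_limit UNIV (\<lambda>s \<theta>. (fst (u s) \<theta> - fst (u t) \<theta>) / (s - t))
      (\<lambda>\<theta>. exp (- 2 * fst (u t) \<theta>) * q \<theta>) (at t within I)"
proof -
  obtain p q where g: "has_gradient k A (u t) (p, q)"
    and d: "has_Ck_state_derivative 0 u (\<lambda>\<theta>. exp (- 2 * fst (u t) \<theta>) * q \<theta>, \<lambda>\<theta>. - exp (- 2 * fst (u t) \<theta>) * p \<theta>) t I"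
    using assms unfolding solves_system_def by blast
  show ?thesis
  proof
    show "has_L2_grad k (\<lambda>\<eta>. A (fst (u t), \<eta>)) (snd (u t)) q"
      using g by (cases "u t") (simp add: has_gradient_def)
    show "uniform_limit UNIV (\<lambda>s \<theta>. (fst (u s) \<theta> - fst (u t) \<theta>) / (s - t))
        (\<lambda>\<theta>. exp (- 2 * fst (u t) \<theta>) * q \<theta>) (at t within I)"
      using d by (simp add: has_Ck_state_derivative_def has_Ck_derivative_def enat_0_iff zero_enat_def)
  qed
qed

text \<open>Invariance under \<open>S\<^sub>a\<close> says exactly that the derivative along \<open>(0, 1)\<close> vanishes.\<close>

lemma L2_grad_shift_invariant_mean_zero:
  assumes inv: "\<And>a. F (\<lambda>\<theta>. f \<theta> + a) = F f" and g: "has_L2_grad k F f g"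
  shows "circle_integral g = 0"
proof -
  have "((\<lambda>t. F (\<lambda>\<theta>. f \<theta> + t * 1)) has_real_derivative L2_inner g (\<lambda>_. 1)) (at 0)"
    by (rule bspec[OF conjunct2[OF g[unfolded has_L2_grad_def]] const_Ck_circle])
  then have "L2_inner g (\<lambda>_. 1) = 0"
    by (auto simp: inv dest: DERIV_unique[OF _ DERIV_const])
  then show ?thesis
    by (simp add: L2_inner_def)
qed

text \<open>Noether's argument on a given solution: in the chain rule the weight exp(-2\<xi>) of the
  equation cancels the gradient exp(2\<xi>), and what remains, the integral of q, is the derivative
  of A along the shifts.\<close>

lemma mass_conserved:
  assumes inv: "\<And>\<xi> chi a. (\<xi>, chi) \<in> phase_space k \<Longrightarrow> A (\<xi>, \<lambda>\<theta>. chi \<theta> + a) = A (\<xi>, chi)"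
    and I: "is_interval I" and u: "solves_system k A I u" and "s \<in> I" "t \<in> I"
  shows "mass (u s) = mass (u t)"
proof -
  have phase: "u r \<in> phase_space k" if "r \<in> I" for r
    using u that by (simp add: solves_system_def)
  have xi: "fst (u r) \<in> Ck_circle k" if "r \<in> I" for r
    using phase[OF that] by (auto simp: phase_space_def)
  have "((\<lambda>s. mass (u s)) has_real_derivative 0) (at r within I)" if r: "r \<in> I" for r
  proof -
    obtain q where q: "has_L2_grad k (\<lambda>\<eta>. A (fst (u r), \<eta>)) (snd (u r)) q"
      and lim: "uniform_limit UNIV (\<lambda>s \<theta>. (fst (u s) \<theta> - fst (u r) \<theta>) / (s - r))
        (\<lambda>\<theta>. exp (- 2 * fst (u r) \<theta>) * q \<theta>) (at r within I)"
      using solves_system_imp_deriv[OF u r] .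
    have "q \<in> Ck_circle 0"
      using q by (simp add: has_L2_grad_def)
    note cont = Ck_circle_continuous[OF xi[OF r]] Ck_circle_continuous[OF this]
    have "((\<lambda>s. 1 / 2 * circle_integral (\<lambda>\<theta>. exp (2 * fst (u s) \<theta>))) has_real_derivative
      L2_inner (\<lambda>\<theta>. exp (2 * fst (u r) \<theta>)) (\<lambda>\<theta>. exp (- 2 * fst (u r) \<theta>) * q \<theta>)) (at r within I)"
      by (rule has_real_derivative_circle_integral_exp[OF _ _ r lim])
         (intro continuous_intros cont Ck_circle_continuous[OF xi], assumption?)+
    moreover have "L2_inner (\<lambda>\<theta>. exp (2 * fst (u r) \<theta>)) (\<lambda>\<theta>. exp (- 2 * fst (u r) \<theta>) * q \<theta>) = circle_integral q"
      by (simp add: L2_inner_def mult.assoc[symmetric] exp_add[symmetric])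
    moreover have "circle_integral q = 0"
      using q by (rule L2_grad_shift_invariant_mean_zero[rotated]) (use phase[OF r] in \<open>simp add: inv\<close>)
    ultimately show ?thesis
      by (simp add: mass_def split_beta)
  qed
  then have "\<exists>c. \<forall>r\<in>I. mass (u r) = c"
    using I by (intro has_field_derivative_zero_constant) (auto simp: is_interval_convex_1)
  then show ?thesis
    using \<open>s \<in> I\<close> \<open>t \<in> I\<close> by metis
qed

lemma poisson_mass:
  assumes inv: "\<And>a. A (\<xi>, \<lambda>\<theta>. chi \<theta> + a) = A (\<xi>, chi)" and xi: "\<xi> \<in> Ck_circle k"
  shows "poisson k mass A (\<xi>, chi) = 0"
proof -
  have "gradient k mass (\<xi>, chi) = (\<lambda>\<theta>. exp (2 * \<xi> \<theta>), \<lambda>_. 0)"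
    using mass_has_gradient[OF xi] by (rule gradient_eq)
  then have "poisson k mass A (\<xi>, chi) = circle_integral (grad_chi k A (\<xi>, chi))"
    by (simp add: poisson_def gradient_def L2_inner_def circle_integral_def exp_add[symmetric])
  also have "\<dots> = 0"
  proof (cases "\<exists>g. has_L2_grad k (\<lambda>\<eta>. A (\<xi>, \<eta>)) chi g")
    case True
    then obtain g where g: "has_L2_grad k (\<lambda>\<eta>. A (\<xi>, \<eta>)) chi g" ..
    then have "circle_integral g = 0"
      by (rule L2_grad_shift_invariant_mean_zero[rotated]) (rule inv)
    then show ?thesis
      by (simp add: grad_chi_def L2_grad_eq[OF g])
  next
    \<comment> \<open>Without a gradient in \<chi>, \<open>L2_grad\<close> has the value 0, whose
      integral vanishes too.\<close>
    case False
    then have "L2_grad k (\<lambda>\<eta>. A (\<xi>, \<eta>)) chi = (\<lambda>_. 0)"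
      unfolding L2_grad_def by (rule if_not_P)
    then show ?thesis
      by (simp add: grad_chi_def circle_integral_def)
  qed
  finally show ?thesis .
qed

lemma mass_translate:
  assumes "\<xi> \<in> Ck_circle k"
  shows "mass (translate \<alpha> (\<xi>, chi)) = mass (\<xi>, chi)"
  using circle_integral_translate[of "\<lambda>\<theta>. exp (2 * \<xi> \<theta>)" \<alpha>]
  by (simp add: mass_def translate_def Ck_circle_periodic[OF assms] Ck_circle_continuous[OF assms]
      continuous_on_exp continuous_on_mult_left)

text \<open>For a \<noteq> 0 the difference quotients equal their limit exactly, so convergence is
  immediate at every order.\<close>

lemma shift_has_Ck_state_derivative:
  "has_Ck_state_derivative k (\<lambda>a. shift a u) (\<lambda>_. 0, \<lambda>_. 1) 0 UNIV"
proof -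
  have "uniform_limit UNIV (\<lambda>s. (deriv ^^ j) (f s)) ((deriv ^^ j) g) (at 0)"
    if "\<And>s. s \<noteq> 0 \<Longrightarrow> f s = g" for f :: "real \<Rightarrow> field" and g j
    by (rule uniform_limitI) (auto simp: eventually_at_filter that)
  then show ?thesis
    by (auto simp: has_Ck_state_derivative_def has_Ck_derivative_def shift_def split_beta)
qed

lemma shift_phase_space: "u \<in> phase_space k \<Longrightarrow> shift a u \<in> phase_space k"
  using Ck_circle_add_cmult[OF _ const_Ck_circle, of _ k a 1]
  by (auto simp: phase_space_def shift_def)

text \<open>The test lines through (\<xi>, \<chi>) stay in the phase space, so the invariance of A
  applies on each of them. In the second claim the shift is moved past the variation t h.\<close>

lemma has_L2_grad_shift:
  assumes inv: "\<And>\<xi> chi a. (\<xi>, chi) \<in> phase_space k \<Longrightarrow> A (\<xi>, \<lambda>\<theta>. chi \<theta> + a) = A (\<xi>, chi)"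
    and u: "(\<xi>, chi) \<in> phase_space k"
  shows "has_L2_grad k (\<lambda>\<eta>. A (\<eta>, \<lambda>\<theta>. chi \<theta> + a)) \<xi> = has_L2_grad k (\<lambda>\<eta>. A (\<eta>, chi)) \<xi>"
    and "has_L2_grad k (\<lambda>\<eta>. A (\<xi>, \<eta>)) (\<lambda>\<theta>. chi \<theta> + a) = has_L2_grad k (\<lambda>\<eta>. A (\<xi>, \<eta>)) chi"
proof -
  have C: "\<xi> \<in> Ck_circle k" "chi \<in> Ck_circle k"
    using u by (auto simp: phase_space_def)
  show "has_L2_grad k (\<lambda>\<eta>. A (\<eta>, \<lambda>\<theta>. chi \<theta> + a)) \<xi> = has_L2_grad k (\<lambda>\<eta>. A (\<eta>, chi)) \<xi>"
    by (rule has_L2_grad_cong, rule inv) (simp add: phase_space_def C Ck_circle_add_cmult)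
  have "A (\<xi>, \<lambda>\<theta>. chi \<theta> + a + t * h \<theta>) = A (\<xi>, \<lambda>\<theta>. chi \<theta> + t * h \<theta>)" if "h \<in> Ck_circle k" for t h
    using inv[of \<xi> "\<lambda>\<theta>. chi \<theta> + t * h \<theta>" a] that
    by (simp add: phase_space_def C Ck_circle_add_cmult add.assoc add.commute[of a])
  then show "has_L2_grad k (\<lambda>\<eta>. A (\<xi>, \<eta>)) (\<lambda>\<theta>. chi \<theta> + a) = has_L2_grad k (\<lambda>\<eta>. A (\<xi>, \<eta>)) chi"
    by (rule has_L2_grad_cong)
qed

section \<open>Calculus in the fluid domain\<close>

lemma C1_on_partials:
  assumes "C1_on U \<Phi>" "(\<rho>, \<theta>) \<in> U"
  shows "((\<lambda>r. \<Phi> (r, \<theta>)) has_real_derivative d_rho \<Phi> (\<rho>, \<theta>)) (at \<rho>)"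
    and "((\<lambda>s. \<Phi> (\<rho>, s)) has_real_derivative d_theta \<Phi> (\<rho>, \<theta>)) (at \<theta>)"
  using assms unfolding C1_on_def
  by (auto simp: d_rho_def d_theta_def DERIV_deriv_iff_real_differentiable)

lemma C1_on_continuous_partials:
  assumes "C1_on U \<Phi>"
  shows "continuous_on U (d_rho \<Phi>)" "continuous_on U (d_theta \<Phi>)"
  using assms by (auto simp: C1_on_def)

text \<open>\<open>C1_on\<close> speaks of partial derivatives only; their continuity gives the
  total derivative, and with it the chain rule along curves.\<close>

lemma C1_on_has_derivative:
  assumes U: "open U" and C1: "C1_on U \<Phi>" and p: "(\<rho>, \<theta>) \<in> U"
  shows "(\<Phi> has_derivative (\<lambda>(a, b). a * d_rho \<Phi> (\<rho>, \<theta>) + b * d_theta \<Phi> (\<rho>, \<theta>))) (at (\<rho>, \<theta>))"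
proof -
  obtain A B where AB: "open A" "open B" "(\<rho>, \<theta>) \<in> A \<times> B" "A \<times> B \<subseteq> U"
    using open_prod_elim[OF U p] .
  \<comment> \<open>A ball in the second variable, because the criterion used below asks for a
    convex set there.\<close>
  then obtain e where e: "e > 0" "ball \<theta> e \<subseteq> B"
    by (meson mem_Sigma_iff open_contains_ball)
  define Y where "Y = ball \<theta> e"
  have sub: "A \<times> Y \<subseteq> U" and pY: "(\<rho>, \<theta>) \<in> A \<times> Y" and open': "open (A \<times> Y)"
    using AB e by (auto simp: Y_def open_Times)
  have "((\<lambda>(x, y). \<Phi> (x, y)) has_derivative
      (\<lambda>(tx, ty). tx * d_rho \<Phi> (\<rho>, \<theta>) + blinfun_mult_left (d_theta \<Phi> (\<rho>, \<theta>)) ty))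
      (at (\<rho>, \<theta>) within A \<times> Y)"
  proof (rule has_derivative_partialsI[where f = "\<lambda>x y. \<Phi> (x, y)" and fy = "\<lambda>x y. blinfun_mult_left (d_theta \<Phi> (x, y))"])
    show "((\<lambda>x. \<Phi> (x, \<theta>)) has_derivative (\<lambda>tx. tx * d_rho \<Phi> (\<rho>, \<theta>))) (at \<rho> within A)"
      using has_derivative_at_withinI[OF C1_on_partials(1)[OF C1 p, unfolded has_field_derivative_def]]
      by (simp add: mult_commute_abs)
    show "((\<lambda>y. \<Phi> (x, y)) has_derivative blinfun_apply (blinfun_mult_left (d_theta \<Phi> (x, y)))) (at y within Y)"
      if "x \<in> A" "y \<in> Y" for x y
    proof -
      have "(x, y) \<in> U"
        using that sub by auto
      then have "((\<lambda>y. \<Phi> (x, y)) has_derivative (\<lambda>t. d_theta \<Phi> (x, y) * t)) (at y within Y)"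
        by (rule has_derivative_at_withinI[OF C1_on_partials(2)[OF C1, unfolded has_field_derivative_def]])
      moreover have "blinfun_apply (blinfun_mult_left (d_theta \<Phi> (x, y))) = (\<lambda>t. d_theta \<Phi> (x, y) * t)"
        by (auto simp: mult.commute)
      ultimately show ?thesis by simp
    qed
    have "continuous_on (A \<times> Y) (\<lambda>p. blinfun_mult_left (d_theta \<Phi> p))"
      by (intro bounded_linear.continuous_on[OF bounded_linear_blinfun_mult_left]
          continuous_on_subset[OF C1_on_continuous_partials(2)[OF C1] sub])
    then show "continuous (at (\<rho>, \<theta>) within A \<times> Y) (\<lambda>(x, y). blinfun_mult_left (d_theta \<Phi> (x, y)))"
      using pY by (simp add: continuous_on_eq_continuous_within split_beta')
  qed (use e in \<open>auto simp: Y_def\<close>)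
  moreover have "at (\<rho>, \<theta>) within A \<times> Y = at (\<rho>, \<theta>)"
    using open' pY by (rule at_within_open[rotated])
  ultimately show ?thesis
    by (simp add: split_beta')
qed

lemma C1_on_continuous: "open U \<Longrightarrow> C1_on U \<Phi> \<Longrightarrow> continuous_on U \<Phi>"
  by (auto intro!: continuous_at_imp_continuous_on dest: C1_on_has_derivative[THEN has_derivative_continuous])

lemma C1_on_curve:
  assumes "open U" "C1_on U \<Phi>" "(\<eta> \<theta>, \<theta>) \<in> U" and \<eta>: "(\<eta> has_real_derivative \<eta>') (at \<theta>)"
  shows "((\<lambda>s. \<Phi> (\<eta> s, s)) has_real_derivative \<eta>' * d_rho \<Phi> (\<eta> \<theta>, \<theta>) + d_theta \<Phi> (\<eta> \<theta>, \<theta>)) (at \<theta>)"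
proof -
  have "((\<lambda>s. (\<eta> s, s)) has_derivative (\<lambda>t. (\<eta>' * t, t))) (at \<theta>)"
    using \<eta> by (auto simp: has_field_derivative_def intro!: has_derivative_Pair)
  from has_derivative_compose[OF this C1_on_has_derivative[OF assms(1-3)]]
  show ?thesis
    unfolding has_field_derivative_def
    by (rule has_derivative_eq_rhs) (auto simp: algebra_simps)
qed

section \<open>Continuity up to the free surface\<close>

lemma open_fluid_domain:
  assumes "continuous_on UNIV \<xi>"
  shows "open (fluid_domain \<xi>)"
proof -
  have "continuous_on UNIV (\<lambda>p::real \<times> real. \<xi> (snd p))"
    by (rule continuous_on_compose2[OF assms]) (auto intro: continuous_on_snd)
  then show ?thesis
    unfolding fluid_domain_def split_beta'
    by (rule open_Collect_less[rotated]) (rule continuous_on_fst[OF continuous_on_id])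
qed

lemma boundary_filter_nontrivial: "at (\<xi> \<theta>, \<theta>) within fluid_domain \<xi> \<noteq> bot"
proof -
  have "\<exists>x'\<in>fluid_domain \<xi>. x' \<noteq> (\<xi> \<theta>, \<theta>) \<and> dist x' (\<xi> \<theta>, \<theta>) < e" if "0 < e" for e
    using that by (intro bexI[of _ "(\<xi> \<theta> - e / 2, \<theta>)"]) (auto simp: fluid_domain_def dist_Pair_Pair dist_real_def)
  then show ?thesis
    by (simp add: trivial_limit_within islimpt_approachable)
qed

text \<open>Within U, f stays e/2-close to \<open>g x\<close> near x. At a nearby boundary point the
  value of g is a limit of such values, hence at most e/2 away.\<close>

lemma continuous_on_boundary_extension:
  fixes f g :: "'a::metric_space \<Rightarrow> 'b::metric_space"
  assumes f: "continuous_on U f" and eq: "\<And>x. x \<in> U \<Longrightarrow> g x = f x"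
    and lim: "\<And>x. x \<in> B \<Longrightarrow> (f \<longlongrightarrow> g x) (at x within U)"
    and nontrivial: "\<And>x. x \<in> B \<Longrightarrow> at x within U \<noteq> bot"
  shows "continuous_on (U \<union> B) g"
  unfolding continuous_on_iff
proof (intro ballI allI impI)
  fix x and e :: real assume x: "x \<in> U \<union> B" and e: "0 < e"
  have "(f \<longlongrightarrow> g x) (at x within U)"
    using x lim f eq by (auto simp: continuous_on_def)
  then have "\<forall>\<^sub>F y in at x within U. dist (f y) (g x) < e / 2"
    using e by (intro tendstoD) auto
  then obtain d where d: "0 < d" "\<And>y. y \<in> U \<Longrightarrow> y \<noteq> x \<Longrightarrow> dist y x < d \<Longrightarrow> dist (f y) (g x) < e / 2"
    unfolding eventually_at by blast
  have "dist (g y) (g x) < e" if y: "y \<in> U \<union> B" "dist y x < d" for y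
  proof (cases "y = x \<or> y \<in> U")
    case True
    then show ?thesis
      using d(2)[of y] y(2) eq[of y] e by force
  next
    case False
    then have "y \<in> B" "y \<noteq> x"
      using y by auto
    \<comment> \<open>The estimate from \<open>at x within U\<close> excludes x itself, so x is
      removed; y still has an open neighbourhood because y \<noteq> x.\<close>
    have "open (ball x d - {x})" "y \<in> ball x d - {x}"
      using y(2) \<open>y \<noteq> x\<close> by (auto simp: open_Diff dist_commute)
    then have "\<forall>\<^sub>F z in at y within U. z \<in> ball x d - {x}"
      using eventually_at_topological by blast
    moreover have "\<forall>\<^sub>F z in at y within U. z \<in> U"
      by (auto simp: eventually_at_filter)
    ultimately have "\<forall>\<^sub>F z in at y within U. dist (f z) (g x) \<le> e / 2"
      by eventually_elim (use d(2) in \<open>fastforce simp: dist_commute\<close>)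
    then have "dist (g y) (g x) \<le> e / 2"
      using tendsto_dist[OF lim[OF \<open>y \<in> B\<close>] tendsto_const] nontrivial[OF \<open>y \<in> B\<close>]
      by (intro tendsto_upperbound)
    then show ?thesis
      using e by simp
  qed
  then show "\<exists>d>0. \<forall>y\<in>U \<union> B. dist y x < d \<longrightarrow> dist (g y) (g x) < e"
    using d(1) by blast
qed

lemma fluid_domain_closure:
  "fluid_domain \<xi> \<union> range (\<lambda>\<theta>. (\<xi> \<theta>, \<theta>)) = {p. fst p \<le> \<xi> (snd p)}"
  by (auto simp: fluid_domain_def image_iff)

lemma continuous_on_fluid_closure:
  fixes f g :: "real \<times> real \<Rightarrow> 'a::metric_space"
  assumes f: "continuous_on (fluid_domain \<xi>) f"
    and eq: "\<And>p. p \<in> fluid_domain \<xi> \<Longrightarrow> g p = f p"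
    and lim: "\<And>\<theta>. (f \<longlongrightarrow> g (\<xi> \<theta>, \<theta>)) (at (\<xi> \<theta>, \<theta>) within fluid_domain \<xi>)"
  shows "continuous_on {p. fst p \<le> \<xi> (snd p)} g"
  unfolding fluid_domain_closure[symmetric]
  by (rule continuous_on_boundary_extension[OF f eq]) (use lim boundary_filter_nontrivial in auto)

section \<open>Uniqueness of the harmonic extension\<close>

text \<open>Fermat gives f'(x) = 0. If D > 0, then f' is positive just to the right of x and the
  mean value theorem makes f larger there than at x.\<close>

lemma second_derivative_local_max:
  fixes f f' :: "real \<Rightarrow> real"
  assumes "0 < d" and f: "\<And>y. \<bar>x - y\<bar> < d \<Longrightarrow> (f has_real_derivative f' y) (at y)"
    and f': "(f' has_real_derivative D) (at x)" and max: "\<And>y. \<bar>x - y\<bar> < d \<Longrightarrow> f y \<le> f x"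
  shows "D \<le> 0"
proof (rule ccontr)
  assume "\<not> D \<le> 0"
  have "f' x = 0"
    using f[of x] \<open>0 < d\<close> max by (intro DERIV_local_max[of f _ x d]) auto
  obtain e where e: "0 < e" "\<And>h. 0 < h \<Longrightarrow> h < e \<Longrightarrow> f' x < f' (x + h)"
    using DERIV_pos_inc_right[OF f'] \<open>\<not> D \<le> 0\<close> by auto
  define y where "y = x + min d e / 2"
  have y: "x < y" "y - x < d" "y - x < e"
    using \<open>0 < d\<close> e(1) by (auto simp: y_def min_def field_simps)
  obtain z where z: "x < z" "z < y" "f y - f x = (y - x) * f' z"
    using MVT2[of x y f f'] y f by auto
  have "0 < f' z"
    using e(2)[of "z - x"] z y \<open>f' x = 0\<close> by simp
  then have "f x < f y"
    using z y(1) by (metis diff_gt_0_iff_gt zero_less_mult_iff)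
  then show False
    using max[of y] y by simp
qed

lemma periodic_int:
  fixes f :: "real \<Rightarrow> 'a"
  assumes "\<And>\<theta>. f (\<theta> + 2 * pi) = f \<theta>"
  shows "f (\<theta> + of_int n * (2 * pi)) = f \<theta>"
proof (induction n arbitrary: \<theta> rule: int_induct[where k = 0])
  case (step1 i)
  have "f (\<theta> + of_int (i + 1) * (2 * pi)) = f (\<theta> + of_int i * (2 * pi) + 2 * pi)"
    by (simp add: algebra_simps)
  then show ?case
    by (simp only: assms step1)
next
  case (step2 i)
  have "f (\<theta> + of_int (i - 1) * (2 * pi)) = f (\<theta> + of_int (i - 1) * (2 * pi) + 2 * pi)"
    by (simp only: assms)
  also have "\<dots> = f (\<theta> + of_int i * (2 * pi))"
    by (simp add: algebra_simps)
  finally show ?case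
    by (simp only: step2)
qed simp

text \<open>The codomain is arbitrary so that several periodic functions, packed into a pair, are
  reduced by the same multiple of 2 pi.\<close>

lemma periodic_reduce:
  fixes f :: "real \<Rightarrow> 'a"
  assumes "\<And>\<theta>. f (\<theta> + 2 * pi) = f \<theta>"
  obtains \<theta>' where "\<theta>' \<in> {0..2 * pi}" "f \<theta>' = f \<theta>"
proof
  define n where "n = \<lfloor>\<theta> / (2 * pi)\<rfloor>"
  have "of_int n \<le> \<theta> / (2 * pi)" "\<theta> / (2 * pi) < of_int n + 1"
    unfolding n_def by linarith+
  then show "\<theta> + of_int (- n) * (2 * pi) \<in> {0..2 * pi}"
    by (simp add: field_simps)
  show "f (\<theta> + of_int (- n) * (2 * pi)) = f \<theta>"
    using assms by (rule periodic_int)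
qed

lemma periodic_bounded:
  fixes f :: "real \<Rightarrow> real"
  assumes per: "\<And>\<theta>. f (\<theta> + 2 * pi) = f \<theta>" and cont: "continuous_on {0..2 * pi} f"
  obtains B where "\<And>\<theta>. \<bar>f \<theta>\<bar> \<le> B"
proof -
  obtain B where B: "\<And>\<theta>. \<theta> \<in> {0..2 * pi} \<Longrightarrow> \<bar>f \<theta>\<bar> \<le> B"
    using compact_imp_bounded[OF compact_continuous_image[OF cont compact_Icc]]
    unfolding bounded_iff by (metis image_eqI real_norm_def)
  have "\<bar>f \<theta>\<bar> \<le> B" for \<theta>
    using periodic_reduce[of f \<theta>] per B by metis
  then show thesis ..
qed

text \<open>
  Since \<open>\<partial>\<^sub>\<rho>V\<close> decays uniformly, \<open>V = o(|\<rho>|)\<close> as \<open>\<rho> \<rightarrow> -\<infinity>\<close>. Hence \<open>V + \<epsilon>\<rho>\<close> attains its supremum, and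
  the strictly subharmonic perturbation \<open>\<epsilon> exp \<rho>\<close> rules out an interior maximum.
\<close>

lemma strip_maximum_principle:
  fixes V Vr Vt Vrr Vtt :: "real \<times> real \<Rightarrow> real"
  assumes cont: "continuous_on UNIV \<xi>" and per: "\<And>\<theta>. \<xi> (\<theta> + 2 * pi) = \<xi> \<theta>"
    and Vper: "\<And>\<rho> \<theta>. V (\<rho>, \<theta> + 2 * pi) = V (\<rho>, \<theta>)"
    and Vcont: "continuous_on {p. fst p \<le> \<xi> (snd p)} V"
    and bdry: "\<And>\<theta>. V (\<xi> \<theta>, \<theta>) \<le> 0"
    and Vr: "\<And>\<rho> \<theta>. \<rho> < \<xi> \<theta> \<Longrightarrow> ((\<lambda>r. V (r, \<theta>)) has_real_derivative Vr (\<rho>, \<theta>)) (at \<rho>)"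
    and Vt: "\<And>\<rho> \<theta>. \<rho> < \<xi> \<theta> \<Longrightarrow> ((\<lambda>s. V (\<rho>, s)) has_real_derivative Vt (\<rho>, \<theta>)) (at \<theta>)"
    and Vrr: "\<And>\<rho> \<theta>. \<rho> < \<xi> \<theta> \<Longrightarrow> ((\<lambda>r. Vr (r, \<theta>)) has_real_derivative Vrr (\<rho>, \<theta>)) (at \<rho>)"
    and Vtt: "\<And>\<rho> \<theta>. \<rho> < \<xi> \<theta> \<Longrightarrow> ((\<lambda>s. Vt (\<rho>, s)) has_real_derivative Vtt (\<rho>, \<theta>)) (at \<theta>)"
    and harm: "\<And>\<rho> \<theta>. \<rho> < \<xi> \<theta> \<Longrightarrow> Vrr (\<rho>, \<theta>) + Vtt (\<rho>, \<theta>) = 0"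
    and decay: "uniform_limit UNIV (\<lambda>\<rho> \<theta>. Vr (\<rho>, \<theta>)) (\<lambda>_. 0) at_bot"
    and p: "\<rho> \<le> \<xi> \<theta>"
  shows "V (\<rho>, \<theta>) \<le> 0"
proof -
  obtain C where C: "\<And>\<theta>. \<bar>\<xi> \<theta>\<bar> \<le> C"
    using periodic_bounded[OF per continuous_on_subset[OF cont subset_UNIV]] by blast
  have main: "V (\<rho>, \<theta>) + \<epsilon> * \<rho> + \<epsilon> * exp \<rho> \<le> \<epsilon> * (C + exp C)" (is "_ \<le> ?top")
    if \<epsilon>: "0 < \<epsilon>" and p: "\<rho> \<le> \<xi> \<theta>" for \<epsilon> \<rho> \<theta>
  proof -
    define W where "W = (\<lambda>p. V p + \<epsilon> * fst p + \<epsilon> * exp (fst p))"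
    have "\<forall>\<^sub>F \<rho> in at_bot. \<forall>\<theta>\<in>UNIV. dist (Vr (\<rho>, \<theta>)) 0 < \<epsilon> / 2"
      using decay \<epsilon> by (intro uniform_limitD) auto
    then obtain R1 where R1: "\<And>\<rho> \<theta>. \<rho> \<le> R1 \<Longrightarrow> \<bar>Vr (\<rho>, \<theta>)\<bar> < \<epsilon> / 2"
      unfolding eventually_at_bot_linorder by auto
    \<comment> \<open>At most R1, where |Vr| < \<epsilon>/2, and below the whole free surface, so
      that the line \<rho> = R0 lies in the fluid.\<close>
    define R0 where "R0 = min R1 (- C - 1)"
    have R0: "R0 < \<xi> \<theta>" "R0 < C" for \<theta>
      using C[of \<theta>] by (auto simp: R0_def min_def abs_le_iff)
    have "continuous_on {0..2 * pi} (\<lambda>\<theta>. V (R0, \<theta>))"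
      by (rule continuous_on_compose2[OF Vcont]) (use R0(1) in \<open>auto intro!: continuous_on_Pair simp: less_imp_le\<close>)
    then obtain B where B: "\<And>\<theta>. \<bar>V (R0, \<theta>)\<bar> \<le> B"
      using periodic_bounded[of "\<lambda>\<theta>. V (R0, \<theta>)"] Vper by blast
    \<comment> \<open>Going down from \<rho> = R0, V rises with slope at most \<epsilon>/2, half the
      slope of the barrier \<epsilon> \<rho>.\<close>
    have low: "V (r, s) \<le> B + \<epsilon> / 2 * (R0 - r)" if r: "r \<le> R0" for r s
    proof (cases "r = R0")
      case True
      then show ?thesis
        using B[of s] by (simp add: abs_le_iff)
    next
      case False
      then have "r < R0"
        using r by simp
      moreover have "((\<lambda>r. V (r, s)) has_real_derivative Vr (x, s)) (at x)" if "x \<le> R0" for x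
        using that R0(1)[of s] by (intro Vr) simp
      ultimately obtain z where z: "z < R0" "V (R0, s) - V (r, s) = (R0 - r) * Vr (z, s)"
        using MVT2[of r R0 "\<lambda>r. V (r, s)" "\<lambda>r. Vr (r, s)"] by auto
      have "- (\<epsilon> / 2) \<le> Vr (z, s)"
        using R1[of z s] z(1) by (simp add: R0_def)
      then have "(R0 - r) * (- (\<epsilon> / 2)) \<le> (R0 - r) * Vr (z, s)"
        using \<open>r < R0\<close> by (intro mult_left_mono) auto
      then show ?thesis
        using B[of s] z(2) by (simp add: abs_le_iff algebra_simps)
    qed
    \<comment> \<open>The second bound solves B + \<epsilon>/2 (R0 - r) + \<epsilon> r \<le>
      \<epsilon> C for r.\<close>
    define R where "R = min R0 (2 * C - R0 - 2 * B / \<epsilon>)"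
    have bottom: "W (r, s) \<le> ?top" if "r \<le> R" for r s
    proof -
      have "r \<le> 2 * C - R0 - 2 * B / \<epsilon>" "r \<le> R0"
        using that by (auto simp: R_def)
      have "\<epsilon> * r \<le> \<epsilon> * (2 * C - R0 - 2 * B / \<epsilon>)"
        using \<epsilon> \<open>r \<le> 2 * C - R0 - 2 * B / \<epsilon>\<close> by (intro mult_left_mono) auto
      then have "\<epsilon> * r \<le> 2 * (\<epsilon> * C) - \<epsilon> * R0 - 2 * B"
        using \<epsilon> by (simp add: algebra_simps)
      moreover have "V (r, s) \<le> B + (\<epsilon> * R0 - \<epsilon> * r) / 2"
        using low[OF \<open>r \<le> R0\<close>, of s] by (simp add: right_diff_distrib diff_divide_distrib)
      \<comment> \<open>Naming the products by variables leaves a linear inequality.\<close>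
      moreover have "v + x \<le> c" if "x \<le> 2 * c - y - 2 * B" "v \<le> B + (y - x) / 2" for v x c y
        using that by (simp add: field_simps)
      ultimately have "V (r, s) + \<epsilon> * r \<le> \<epsilon> * C"
        by blast
      moreover have "\<epsilon> * exp r \<le> \<epsilon> * exp C"
        using \<epsilon> \<open>r \<le> R0\<close> R0(2) by simp
      ultimately show ?thesis
        unfolding W_def distrib_left fst_conv by (rule add_mono)
    qed
    define K where "K = {p. fst p \<le> \<xi> (snd p)} \<inter> ({R..C} \<times> {0..2 * pi})"
    have "continuous_on UNIV (\<lambda>p::real \<times> real. \<xi> (snd p))"
      by (rule continuous_on_compose2[OF cont]) (auto intro: continuous_on_snd)
    then have "closed {p. fst p \<le> \<xi> (snd p)}"
      by (rule closed_Collect_le[rotated]) (rule continuous_on_fst[OF continuous_on_id])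
    then have "compact K"
      unfolding K_def by (intro closed_Int_compact compact_Times) auto
    moreover have "(R, 0) \<in> K"
      using R0(1)[of 0] R0(2) by (auto simp: K_def R_def)
    moreover have contW: "continuous_on K W"
      unfolding W_def K_def
      by (intro continuous_intros continuous_on_subset[OF Vcont]) auto
    ultimately obtain q where q: "q \<in> K" "\<And>p. p \<in> K \<Longrightarrow> W p \<le> W q"
      using continuous_attains_sup[of K W] by blast
    \<comment> \<open>By periodicity the maximum over one cell is a maximum over all \<theta>, so it
      remains a local one when q lies on the edge \<theta> = 0 or 2 pi.\<close>
    have sup: "W (r, s) \<le> W q" if rs: "R \<le> r" "r \<le> \<xi> s" for r s
    proof -
      obtain s' where s': "s' \<in> {0..2 * pi}" "(\<xi> s', V (r, s')) = (\<xi> s, V (r, s))"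
        by (rule periodic_reduce[of "\<lambda>s. (\<xi> s, V (r, s))" s]) (simp_all add: per Vper)
      then have "(r, s') \<in> K"
        using rs C[of s] by (auto simp: K_def abs_le_iff)
      then show ?thesis
        using q(2)[of "(r, s')"] s'(2) by (simp add: W_def)
    qed
    obtain a b where ab: "q = (a, b)"
      by (cases q)
    have a: "R \<le> a" "a \<le> \<xi> b"
      using q(1) by (auto simp: K_def ab)
    have "W q \<le> ?top"
    proof (rule ccontr)
      assume not: "\<not> W q \<le> ?top"
      then have "R < a"
        using bottom[of a b] by (force simp: ab)
      have "a \<noteq> \<xi> b"
      proof
        assume "a = \<xi> b"
        then have "W q \<le> \<epsilon> * \<xi> b + \<epsilon> * exp (\<xi> b)"
          using bdry[of b] by (simp add: W_def ab)
        also have "\<dots> \<le> \<epsilon> * C + \<epsilon> * exp C"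
          using C[of b] \<epsilon> by (intro add_mono mult_left_mono) auto
        finally show False
          using not by (simp add: distrib_left)
      qed
      then have "a < \<xi> b"
        using a(2) by simp
      have "Vrr (a, b) + \<epsilon> * exp a \<le> 0"
      proof (rule second_derivative_local_max)
        show "0 < min (a - R) (\<xi> b - a)"
          using \<open>R < a\<close> \<open>a < \<xi> b\<close> by simp
        show "((\<lambda>r. W (r, b)) has_real_derivative Vr (y, b) + \<epsilon> + \<epsilon> * exp y) (at y)"
          if "\<bar>a - y\<bar> < min (a - R) (\<xi> b - a)" for y
          unfolding W_def using that by (auto intro!: derivative_eq_intros Vr)
        show "((\<lambda>y. Vr (y, b) + \<epsilon> + \<epsilon> * exp y) has_real_derivative Vrr (a, b) + \<epsilon> * exp a) (at a)"
          using \<open>a < \<xi> b\<close> by (auto intro!: derivative_eq_intros Vrr)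
        show "W (y, b) \<le> W (a, b)" if "\<bar>a - y\<bar> < min (a - R) (\<xi> b - a)" for y
        proof -
          have "R \<le> y" "y \<le> \<xi> b"
            using that unfolding min_less_iff_conj by linarith+
          then show ?thesis
            using sup[of y b] by (simp add: ab)
        qed
      qed
      moreover have "Vtt (a, b) \<le> 0"
      proof -
        have "isCont \<xi> b"
          using cont by (simp add: continuous_on_eq_continuous_at)
        then obtain d where d: "0 < d" "\<And>s. dist s b < d \<Longrightarrow> dist (\<xi> s) (\<xi> b) < \<xi> b - a"
          using \<open>a < \<xi> b\<close> unfolding continuous_at_eps_delta by (meson diff_gt_0_iff_gt)
        have near: "a < \<xi> s" if "\<bar>b - s\<bar> < d" for s
          using d(2)[of s] that by (auto simp: dist_real_def abs_minus_commute)
        show ?thesis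
        proof (rule second_derivative_local_max[OF d(1)])
          show "((\<lambda>s. W (a, s)) has_real_derivative Vt (a, y)) (at y)" if "\<bar>b - y\<bar> < d" for y
            unfolding W_def using near[OF that] by (auto intro!: derivative_eq_intros Vt)
          show "((\<lambda>y. Vt (a, y)) has_real_derivative Vtt (a, b)) (at b)"
            using \<open>a < \<xi> b\<close> by (rule Vtt)
          show "W (a, y) \<le> W (a, b)" if "\<bar>b - y\<bar> < d" for y
            using near[OF that] sup[of a y] a(1) by (simp add: ab)
        qed
      qed
      moreover have "0 < \<epsilon> * exp a"
        using \<epsilon> by simp
      ultimately show False
        using harm[OF \<open>a < \<xi> b\<close>] by linarith
    qed
    moreover have "W (\<rho>, \<theta>) \<le> ?top \<or> W (\<rho>, \<theta>) \<le> W q"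
      using bottom sup p by (meson linear)
    ultimately have "W (\<rho>, \<theta>) \<le> ?top"
      by linarith
    then show ?thesis
      by (simp add: W_def)
  qed
  define D where "D = C + exp C - \<rho> - exp \<rho>"
  have D: "V (\<rho>, \<theta>) \<le> \<epsilon> * D" if "0 < \<epsilon>" for \<epsilon>
    using main[OF that p] by (simp add: D_def algebra_simps)
  show ?thesis
  proof (rule ccontr)
    assume "\<not> V (\<rho>, \<theta>) \<le> 0"
    then have V: "0 < V (\<rho>, \<theta>)"
      by simp
    \<comment> \<open>With \<epsilon> = V / (2 (|D| + 1)) the bound \<epsilon> D is at most V / 2,
      whatever the sign of D.\<close>
    have "V (\<rho>, \<theta>) \<le> V (\<rho>, \<theta>) / (2 * (\<bar>D\<bar> + 1)) * D"
      using V by (intro D) simp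
    also have "\<dots> \<le> V (\<rho>, \<theta>) / (2 * (\<bar>D\<bar> + 1)) * (\<bar>D\<bar> + 1)"
      using V by (intro mult_left_mono) auto
    also have "\<dots> = V (\<rho>, \<theta>) / 2"
      by (simp add: field_simps)
    finally show False
      using V by simp
  qed
qed

lemma harmonic_onD:
  assumes "harmonic_on U \<Phi>"
  shows "C1_on U \<Phi>" "C1_on U (d_rho \<Phi>)" "C1_on U (d_theta \<Phi>)"
    and "p \<in> U \<Longrightarrow> d_rho (d_rho \<Phi>) p + d_theta (d_theta \<Phi>) p = 0"
  using assms by (auto simp: harmonic_on_def)

lemma harmonic_extensionD:
  assumes "harmonic_extension \<xi> chi \<Phi>"
  shows "\<Phi> (\<rho>, \<theta> + 2 * pi) = \<Phi> (\<rho>, \<theta>)" "harmonic_on (fluid_domain \<xi>) \<Phi>" "\<Phi> (\<xi> \<theta>, \<theta>) = chi \<theta>"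
    and "(\<Phi> \<longlongrightarrow> \<Phi> (\<xi> \<theta>, \<theta>)) (at (\<xi> \<theta>, \<theta>) within fluid_domain \<xi>)"
    and "uniform_limit UNIV (\<lambda>\<rho> \<theta>. d_rho \<Phi> (\<rho>, \<theta>)) (\<lambda>_. 0) at_bot"
  using assms by (auto simp: harmonic_extension_def)

lemma harmonic_extension_continuous:
  assumes "continuous_on UNIV \<xi>" "harmonic_extension \<xi> chi \<Phi>"
  shows "continuous_on {p. fst p \<le> \<xi> (snd p)} \<Phi>"
proof (rule continuous_on_fluid_closure)
  show "continuous_on (fluid_domain \<xi>) \<Phi>"
    using assms by (intro C1_on_continuous open_fluid_domain harmonic_onD(1) harmonic_extensionD(2))
qed (simp_all add: harmonic_extensionD(4)[OF assms(2)])

text \<open>A comparison principle: \<Phi> - \<Psi> - a is harmonic, nonpositive on the surface, and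
  its radial derivative decays. Applied in both directions, with a and -a, it yields
  equality.\<close>

lemma harmonic_extension_le:
  assumes \<xi>: "continuous_on UNIV \<xi>" "\<And>\<theta>. \<xi> (\<theta> + 2 * pi) = \<xi> \<theta>"
    and ext: "harmonic_extension \<xi> chi \<Phi>" "harmonic_extension \<xi> chi' \<Psi>"
    and le: "\<And>\<theta>. chi \<theta> \<le> chi' \<theta> + a" and p: "(\<rho>, \<theta>) \<in> fluid_domain \<xi>"
  shows "\<Phi> (\<rho>, \<theta>) \<le> \<Psi> (\<rho>, \<theta>) + a"
proof -
  note h = ext[THEN harmonic_extensionD(2)]
  have "\<Phi> (\<rho>, \<theta>) - \<Psi> (\<rho>, \<theta>) - a \<le> 0"
  proof (rule strip_maximum_principle[OF \<xi>, where V = "\<lambda>p. \<Phi> p - \<Psi> p - a"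
        and Vr = "\<lambda>p. d_rho \<Phi> p - d_rho \<Psi> p" and Vt = "\<lambda>p. d_theta \<Phi> p - d_theta \<Psi> p"
        and Vrr = "\<lambda>p. d_rho (d_rho \<Phi>) p - d_rho (d_rho \<Psi>) p"
        and Vtt = "\<lambda>p. d_theta (d_theta \<Phi>) p - d_theta (d_theta \<Psi>) p"])
    show "continuous_on {p. fst p \<le> \<xi> (snd p)} (\<lambda>p. \<Phi> p - \<Psi> p - a)"
      using \<xi>(1) ext by (intro continuous_on_diff continuous_on_const harmonic_extension_continuous)
    show "\<Phi> (\<xi> \<theta>, \<theta>) - \<Psi> (\<xi> \<theta>, \<theta>) - a \<le> 0" for \<theta>
      using le[of \<theta>] by (simp add: harmonic_extensionD(3)[OF ext(1)] harmonic_extensionD(3)[OF ext(2)])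
    fix r s assume "r < \<xi> s"
    then have rs: "(r, s) \<in> fluid_domain \<xi>"
      by (simp add: fluid_domain_def)
    note parts = C1_on_partials[OF h(1)[THEN harmonic_onD(1)] rs] C1_on_partials[OF h(2)[THEN harmonic_onD(1)] rs]
      C1_on_partials(1)[OF h(1)[THEN harmonic_onD(2)] rs] C1_on_partials(1)[OF h(2)[THEN harmonic_onD(2)] rs]
      C1_on_partials(2)[OF h(1)[THEN harmonic_onD(3)] rs] C1_on_partials(2)[OF h(2)[THEN harmonic_onD(3)] rs]
    show "((\<lambda>r. \<Phi> (r, s) - \<Psi> (r, s) - a) has_real_derivative d_rho \<Phi> (r, s) - d_rho \<Psi> (r, s)) (at r)"
      "((\<lambda>s. \<Phi> (r, s) - \<Psi> (r, s) - a) has_real_derivative d_theta \<Phi> (r, s) - d_theta \<Psi> (r, s)) (at s)"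
      using DERIV_diff[OF DERIV_diff[OF parts(1,3)] DERIV_const[of a]]
        DERIV_diff[OF DERIV_diff[OF parts(2,4)] DERIV_const[of a]] by simp_all
    show "((\<lambda>r. d_rho \<Phi> (r, s) - d_rho \<Psi> (r, s)) has_real_derivative
        d_rho (d_rho \<Phi>) (r, s) - d_rho (d_rho \<Psi>) (r, s)) (at r)"
      "((\<lambda>s. d_theta \<Phi> (r, s) - d_theta \<Psi> (r, s)) has_real_derivative
        d_theta (d_theta \<Phi>) (r, s) - d_theta (d_theta \<Psi>) (r, s)) (at s)"
      by (rule DERIV_diff parts)+
    show "d_rho (d_rho \<Phi>) (r, s) - d_rho (d_rho \<Psi>) (r, s)
        + (d_theta (d_theta \<Phi>) (r, s) - d_theta (d_theta \<Psi>) (r, s)) = 0"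
      using h(1)[THEN harmonic_onD(4), OF rs] h(2)[THEN harmonic_onD(4), OF rs] by linarith
  next
    show "uniform_limit UNIV (\<lambda>\<rho> \<theta>. d_rho \<Phi> (\<rho>, \<theta>) - d_rho \<Psi> (\<rho>, \<theta>)) (\<lambda>_. 0) at_bot"
      using uniform_limit_minus[OF ext[THEN harmonic_extensionD(5)]] by simp
  qed (use p in \<open>auto simp: fluid_domain_def harmonic_extensionD(1)[OF ext(1)] harmonic_extensionD(1)[OF ext(2)]\<close>)
  then show ?thesis by simp
qed

lemma harmonic_extension_unique:
  assumes "continuous_on UNIV \<xi>" "\<And>\<theta>. \<xi> (\<theta> + 2 * pi) = \<xi> \<theta>"
    and "harmonic_extension \<xi> (\<lambda>\<theta>. chi \<theta> + a) \<Phi>" "harmonic_extension \<xi> chi \<Psi>" and p: "p \<in> fluid_domain \<xi>"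
  shows "\<Phi> p = \<Psi> p + a"
proof (cases p)
  case (Pair \<rho> \<theta>)
  have "\<Phi> (\<rho>, \<theta>) \<le> \<Psi> (\<rho>, \<theta>) + a"
    using p Pair by (intro harmonic_extension_le[OF assms(1,2,3,4)]) auto
  moreover have "\<Psi> (\<rho>, \<theta>) \<le> \<Phi> (\<rho>, \<theta>) + - a"
    using p Pair by (intro harmonic_extension_le[OF assms(1,2,4,3)]) auto
  ultimately show ?thesis
    using Pair by simp
qed

section \<open>The Dirichlet-Neumann operator\<close>

text \<open>Proved on the level of the derivative predicate: \<open>deriv\<close> selects a number
  satisfying it, so the identity also holds where no derivative exists.\<close>

lemma d_rho_add_const: "d_rho (\<lambda>p. \<Phi> p + a) = d_rho \<Phi>"
proof -
  have "DERIV (\<lambda>r. f r + a) x :> D \<longleftrightarrow> DERIV f x :> D" for f :: field and x D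
    by (simp add: DERIV_def)
  then show ?thesis
    by (simp add: d_rho_def deriv_def fun_eq_iff)
qed

lemma d_theta_add_const: "d_theta (\<lambda>p. \<Phi> p + a) = d_theta \<Phi>"
proof -
  have "DERIV (\<lambda>r. f r + a) x :> D \<longleftrightarrow> DERIV f x :> D" for f :: field and x D
    by (simp add: DERIV_def)
  then show ?thesis
    by (simp add: d_theta_def deriv_def fun_eq_iff)
qed

lemma harmonic_extension_add_const:
  assumes "harmonic_extension \<xi> chi \<Phi>"
  shows "harmonic_extension \<xi> (\<lambda>\<theta>. chi \<theta> + a) (\<lambda>p. \<Phi> p + a)"
proof -
  have "(\<lambda>r. f r + a) differentiable (at x) \<longleftrightarrow> f differentiable (at x)" for f :: field and x
    by (simp add: real_differentiable_def DERIV_def)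
  then have "C1_on U (\<lambda>p. \<Phi> p + a) = C1_on U \<Phi>" for U
    by (simp add: C1_on_def d_rho_add_const d_theta_add_const)
  then show ?thesis
    using assms
    by (auto simp: harmonic_extension_def harmonic_on_def d_rho_add_const d_theta_add_const intro!: tendsto_add)
qed

lemma boundary_value_cong:
  assumes "\<And>p. p \<in> fluid_domain \<xi> \<Longrightarrow> f p = g p"
  shows "boundary_value \<xi> f = boundary_value \<xi> g"
proof
  fix \<theta>
  have "(f \<longlongrightarrow> l) (at (\<xi> \<theta>, \<theta>) within fluid_domain \<xi>) \<longleftrightarrow> (g \<longlongrightarrow> l) (at (\<xi> \<theta>, \<theta>) within fluid_domain \<xi>)" for l
    by (rule tendsto_cong) (auto simp: eventually_at_filter assms)
  then show "boundary_value \<xi> f \<theta> = boundary_value \<xi> g \<theta>"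
    by (simp add: boundary_value_def t2_space_class.Lim_def)
qed

text \<open>Two extensions may differ above the surface, and so may their partials on the surface
  itself. The limits in \<open>boundary_value\<close> are taken from the open fluid domain, where
  equality of the potentials passes to the partials.\<close>

lemma DN_eq:
  assumes \<xi>: "continuous_on UNIV \<xi>" "\<And>\<theta>. \<xi> (\<theta> + 2 * pi) = \<xi> \<theta>" and ext: "harmonic_extension \<xi> chi \<Phi>"
  shows "DN \<xi> chi = (\<lambda>\<theta>. boundary_value \<xi> (d_rho \<Phi>) \<theta> - deriv \<xi> \<theta> * boundary_value \<xi> (d_theta \<Phi>) \<theta>)"
proof -
  define \<Psi> where "\<Psi> = (SOME \<Phi>. harmonic_extension \<xi> chi \<Phi>)"
  have \<Psi>: "harmonic_extension \<xi> chi \<Psi>"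
    unfolding \<Psi>_def using someI_ex[of "harmonic_extension \<xi> chi"] ext by blast
  have eq: "\<Phi> p = \<Psi> p" if "p \<in> fluid_domain \<xi>" for p
    using harmonic_extension_unique[OF \<xi>, of chi 0] ext \<Psi> that by simp
  note op = open_fluid_domain[OF \<xi>(1)]
  have partials: "d_rho \<Phi> p = d_rho \<Psi> p \<and> d_theta \<Phi> p = d_theta \<Psi> p" if p: "p \<in> fluid_domain \<xi>" for p
  proof (cases p)
    case (Pair r s)
    have "\<forall>\<^sub>F x in nhds p. x \<in> fluid_domain \<xi>"
      using op p by (rule eventually_nhds_in_open)
    then have ev: "\<forall>\<^sub>F x in nhds p. \<Phi> x = \<Psi> x"
      by eventually_elim (rule eq)
    have "((\<lambda>r. (r, s)) \<longlongrightarrow> (r, s)) (nhds r)" "((\<lambda>s. (r, s)) \<longlongrightarrow> (r, s)) (nhds s)"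
      by (intro tendsto_intros filterlim_ident)+
    from this[THEN eventually_compose_filterlim[rotated], OF ev[unfolded Pair]]
    show ?thesis
      unfolding d_rho_def d_theta_def Pair prod.case by (auto intro: deriv_cong_ev)
  qed
  have "boundary_value \<xi> (d_rho \<Phi>) = boundary_value \<xi> (d_rho \<Psi>)"
    "boundary_value \<xi> (d_theta \<Phi>) = boundary_value \<xi> (d_theta \<Psi>)"
    using partials by (auto intro: boundary_value_cong)
  then show ?thesis
    using ext by (auto simp: DN_def \<Psi>_def Let_def)
qed

lemma DN_add_const:
  assumes "continuous_on UNIV \<xi>" "\<And>\<theta>. \<xi> (\<theta> + 2 * pi) = \<xi> \<theta>"
  shows "DN \<xi> (\<lambda>\<theta>. chi \<theta> + a) = DN \<xi> chi"
proof (cases "\<exists>\<Phi>. harmonic_extension \<xi> chi \<Phi>")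
  case True
  then obtain \<Phi> where "harmonic_extension \<xi> chi \<Phi>" ..
  from DN_eq[OF assms this] DN_eq[OF assms harmonic_extension_add_const[OF this]] show ?thesis
    by (simp add: d_rho_add_const d_theta_add_const)
next
  case False
  \<comment> \<open>Subtracting a would turn an extension of \<chi> + a into one of \<chi>, so both
    sides take the default 0.\<close>
  moreover have "\<not> harmonic_extension \<xi> (\<lambda>\<theta>. chi \<theta> + a) \<Phi>" for \<Phi>
    using harmonic_extension_add_const[of \<xi> "\<lambda>\<theta>. chi \<theta> + a" \<Phi> "- a"] False by auto
  ultimately show ?thesis
    by (simp add: DN_def)
qed

section \<open>Flux through curves in the fluid\<close>

lemma d_theta_periodic:
  assumes "\<And>\<rho> \<theta>. \<Phi> (\<rho>, \<theta> + 2 * pi) = \<Phi> (\<rho>, \<theta>)"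
  shows "d_theta \<Phi> (\<rho>, \<theta> + 2 * pi) = d_theta \<Phi> (\<rho>, \<theta>)"
proof -
  have "DERIV (\<lambda>s. \<Phi> (\<rho>, s)) (\<theta> + 2 * pi) :> D \<longleftrightarrow> DERIV (\<lambda>s. \<Phi> (\<rho>, s)) \<theta> :> D" for D
    by (simp only: DERIV_shift assms)
  then show ?thesis
    by (simp add: d_theta_def deriv_def)
qed

text \<open>
  The flux through the curve \<open>\<rho> = \<eta>(\<theta>)\<close> is \<open>\<integral> (\<partial>\<^sub>\<rho>\<Phi> - \<eta>' \<partial>\<^sub>\<theta>\<Phi>)(\<eta>(\<theta>), \<theta>) d\<theta>\<close>. Along \<open>\<eta> = a + \<tau>b\<close> the \<open>\<tau>\<close>-derivative
  of the integrand is, by harmonicity, the total \<open>\<theta>\<close>-derivative of \<open>- b \<partial>\<^sub>\<theta>\<Phi>(\<eta>(\<theta>), \<theta>)\<close>.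
\<close>

lemma flux_homotopy_invariant:
  assumes U: "open U" and h: "harmonic_on U \<Phi>" and per: "\<And>\<rho> \<theta>. \<Phi> (\<rho>, \<theta> + 2 * pi) = \<Phi> (\<rho>, \<theta>)"
    and a: "\<And>\<theta>. (a has_real_derivative a' \<theta>) (at \<theta>)" "continuous_on UNIV a'" "a (2 * pi) = a 0"
    and b: "\<And>\<theta>. (b has_real_derivative b' \<theta>) (at \<theta>)" "continuous_on UNIV b'" "b (2 * pi) = b 0"
    and inU: "\<And>\<tau> \<theta>. 0 \<le> \<tau> \<Longrightarrow> \<tau> \<le> 1 \<Longrightarrow> (a \<theta> + \<tau> * b \<theta>, \<theta>) \<in> U"
  shows "circle_integral (\<lambda>\<theta>. d_rho \<Phi> (a \<theta>, \<theta>) - a' \<theta> * d_theta \<Phi> (a \<theta>, \<theta>)) =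
    circle_integral (\<lambda>\<theta>. d_rho \<Phi> (a \<theta> + b \<theta>, \<theta>) - (a' \<theta> + b' \<theta>) * d_theta \<Phi> (a \<theta> + b \<theta>, \<theta>))"
proof -
  define \<eta> where "\<eta> = (\<lambda>\<tau> \<theta>. a \<theta> + \<tau> * b \<theta>)"
  define \<eta>' where "\<eta>' = (\<lambda>\<tau> \<theta>. a' \<theta> + \<tau> * b' \<theta>)"
  define f where "f = (\<lambda>\<tau> \<theta>. d_rho \<Phi> (\<eta> \<tau> \<theta>, \<theta>) - \<eta>' \<tau> \<theta> * d_theta \<Phi> (\<eta> \<tau> \<theta>, \<theta>))"
  \<comment> \<open>The mixed derivative appears as \<open>d_rho (d_theta \<Phi>)\<close>, in the
    same order in which the chain rule for \<open>d_theta \<Phi>\<close> along the curve produces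
    it.\<close>
  define ft where "ft = (\<lambda>\<tau> \<theta>. d_rho (d_rho \<Phi>) (\<eta> \<tau> \<theta>, \<theta>) * b \<theta>
    - (b' \<theta> * d_theta \<Phi> (\<eta> \<tau> \<theta>, \<theta>) + \<eta>' \<tau> \<theta> * (d_rho (d_theta \<Phi>) (\<eta> \<tau> \<theta>, \<theta>) * b \<theta>)))"
  note C1 = harmonic_onD(1-3)[OF h]
  have inU': "(\<eta> \<tau> \<theta>, \<theta>) \<in> U" if "\<tau> \<in> {0..1}" for \<tau> \<theta>
    using inU that by (simp add: \<eta>_def)
  have conta: "continuous_on UNIV a" and contb: "continuous_on UNIV b"
    using a(1) b(1) by (auto intro: DERIV_isCont continuous_at_imp_continuous_on)
  have snd': "continuous_on A (\<lambda>p. f (snd p))" if "continuous_on UNIV f"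
    for f :: field and A :: "(real \<times> real) set"
    by (rule continuous_on_compose2[OF that]) (auto intro: continuous_on_snd)
  have cont_curve: "continuous_on ({0..1} \<times> {0..2 * pi}) (\<lambda>p. g (\<eta> (fst p) (snd p), snd p))"
    if "continuous_on U g" for g :: "real \<times> real \<Rightarrow> real"
  proof (rule continuous_on_compose2[OF that])
    show "continuous_on ({0..1} \<times> {0..2 * pi}) (\<lambda>p. (\<eta> (fst p) (snd p), snd p))"
      unfolding \<eta>_def by (intro continuous_intros snd' conta contb)
  qed (use inU' in auto)
  have slice: "continuous_on {0..2 * pi} (\<lambda>\<theta>. F \<tau> \<theta>)"
    if "continuous_on ({0..1} \<times> {0..2 * pi}) (\<lambda>p. F (fst p) (snd p))" "\<tau> \<in> {0..1}"
    for F :: "real \<Rightarrow> real \<Rightarrow> real" and \<tau>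
    using continuous_on_compose2[OF that(1) continuous_on_Pair[OF continuous_on_const continuous_on_id], of \<tau> "{0..2 * pi}"] that(2)
    by (simp add: image_subset_iff)
  have contf: "continuous_on ({0..1} \<times> {0..2 * pi}) (\<lambda>p. f (fst p) (snd p))"
    unfolding f_def \<eta>'_def
    by (intro continuous_intros snd' a(2) b(2) cont_curve C1_on_continuous_partials C1)
  have contft: "continuous_on ({0..1} \<times> {0..2 * pi}) (\<lambda>p. ft (fst p) (snd p))"
    unfolding ft_def \<eta>'_def
    by (intro continuous_intros snd' a(2) b(2) contb cont_curve C1_on_continuous_partials C1)
  have "((\<lambda>\<tau>. integral {0..2 * pi} (f \<tau>)) has_real_derivative 0) (at \<tau> within {0..1})" if \<tau>: "\<tau> \<in> {0..1}" for \<tau>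
  proof -
    have "((\<lambda>\<tau>. integral (cbox 0 (2 * pi)) (f \<tau>)) has_real_derivative integral (cbox 0 (2 * pi)) (ft \<tau>)) (at \<tau> within {0..1})"
    proof (rule leibniz_rule_field_derivative)
      fix \<sigma> \<theta> assume \<sigma>: "\<sigma> \<in> {0..1::real}"
      have "((\<lambda>\<tau>. \<eta> \<tau> \<theta>) has_real_derivative b \<theta>) (at \<sigma>)"
        unfolding \<eta>_def by (auto intro!: derivative_eq_intros)
      note chain = this[THEN DERIV_chain2[rotated]]
      have "((\<lambda>\<tau>. \<eta>' \<tau> \<theta>) has_real_derivative b' \<theta>) (at \<sigma>)"
        unfolding \<eta>'_def by (auto intro!: derivative_eq_intros)
      note prod = DERIV_mult[OF this chain[OF C1_on_partials(1)[OF C1(3) inU'[OF \<sigma>]]]]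
      have "((\<lambda>\<tau>. f \<tau> \<theta>) has_real_derivative ft \<sigma> \<theta>) (at \<sigma>)"
        using DERIV_diff[OF chain[OF C1_on_partials(1)[OF C1(2) inU'[OF \<sigma>]]] prod]
        unfolding f_def ft_def by (rule DERIV_cong) (simp add: algebra_simps)
      then show "((\<lambda>\<tau>. f \<tau> \<theta>) has_real_derivative ft \<sigma> \<theta>) (at \<sigma> within {0..1})"
        by (rule has_field_derivative_at_within)
    next
      show "f \<sigma> integrable_on cbox 0 (2 * pi)" if "\<sigma> \<in> {0..1}" for \<sigma>
        using slice[OF contf that] by (simp add: integrable_continuous_real)
      show "continuous_on ({0..1} \<times> cbox 0 (2 * pi)) (\<lambda>(\<tau>, \<theta>). ft \<tau> \<theta>)"
        using contft by (simp add: split_beta')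
    qed (use \<tau> in auto)
    moreover have "(ft \<tau> has_integral - (b (2 * pi) * d_theta \<Phi> (\<eta> \<tau> (2 * pi), 2 * pi)) - - (b 0 * d_theta \<Phi> (\<eta> \<tau> 0, 0))) {0..2 * pi}"
    proof (rule fundamental_theorem_of_calculus)
      fix \<theta>
      have "(\<eta> \<tau> has_real_derivative \<eta>' \<tau> \<theta>) (at \<theta>)"
        unfolding \<eta>_def \<eta>'_def by (rule DERIV_add[OF a(1) DERIV_cmult[OF b(1)]])
      note curve = C1_on_curve[OF U C1(3) inU'[OF \<tau>] this]
      have "d_theta (d_theta \<Phi>) (\<eta> \<tau> \<theta>, \<theta>) = - d_rho (d_rho \<Phi>) (\<eta> \<tau> \<theta>, \<theta>)"
        using harmonic_onD(4)[OF h inU'[OF \<tau>, of \<theta>]] by simp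
      then have "((\<lambda>\<theta>. - (b \<theta> * d_theta \<Phi> (\<eta> \<tau> \<theta>, \<theta>))) has_real_derivative ft \<tau> \<theta>) (at \<theta>)"
        using DERIV_minus[OF DERIV_mult[OF b(1)[of \<theta>] curve]]
        unfolding ft_def by (elim DERIV_cong) (simp add: algebra_simps)
      then show "((\<lambda>\<theta>. - (b \<theta> * d_theta \<Phi> (\<eta> \<tau> \<theta>, \<theta>))) has_vector_derivative ft \<tau> \<theta>) (at \<theta> within {0..2 * pi})"
        unfolding has_real_derivative_iff_has_vector_derivative[symmetric]
        by (rule has_field_derivative_at_within)
    qed simp
    \<comment> \<open>The endpoint terms cancel: \<Phi> is periodic and the curves close up.\<close>
    then have "integral {0..2 * pi} (ft \<tau>) = 0"
      using d_theta_periodic[of \<Phi> "\<eta> \<tau> 0" 0] per a(3) b(3) by (simp add: integral_unique \<eta>_def)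
    ultimately show ?thesis
      by simp
  qed
  then have "\<exists>c. \<forall>\<tau>\<in>{0..1}. integral {0..2 * pi} (f \<tau>) = c"
    by (intro has_field_derivative_zero_constant) auto
  then have "integral {0..2 * pi} (f 0) = integral {0..2 * pi} (f 1)"
    by force
  then show ?thesis
    by (simp add: circle_integral_def f_def \<eta>_def \<eta>'_def)
qed

text \<open>On the free surface itself \<open>d_rho \<Phi>\<close> and \<open>d_theta \<Phi>\<close>
  also depend on \<Phi> above it. Gluing the interior values to their boundary limits gives
  functions that are continuous up to the surface.\<close>

lemma boundary_value_continuous_extension:
  assumes f: "continuous_on (fluid_domain \<xi>) f"
    and lim: "\<And>\<theta>. \<exists>l. (f \<longlongrightarrow> l) (at (\<xi> \<theta>, \<theta>) within fluid_domain \<xi>)"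
  obtains g where "continuous_on {p. fst p \<le> \<xi> (snd p)} g"
    and "\<And>p. p \<in> fluid_domain \<xi> \<Longrightarrow> g p = f p" and "\<And>\<theta>. g (\<xi> \<theta>, \<theta>) = boundary_value \<xi> f \<theta>"
proof
  define g where "g = (\<lambda>p. if p \<in> fluid_domain \<xi> then f p else boundary_value \<xi> f (snd p))"
  show eq: "g p = f p" if "p \<in> fluid_domain \<xi>" for p
    using that by (simp add: g_def)
  show g: "g (\<xi> \<theta>, \<theta>) = boundary_value \<xi> f \<theta>" for \<theta>
    by (simp add: g_def fluid_domain_def)
  show "continuous_on {p. fst p \<le> \<xi> (snd p)} g"
  proof (rule continuous_on_fluid_closure[OF f eq])
    fix \<theta>
    obtain l where l: "(f \<longlongrightarrow> l) (at (\<xi> \<theta>, \<theta>) within fluid_domain \<xi>)"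
      using lim by blast
    then have "boundary_value \<xi> f \<theta> = l"
      unfolding boundary_value_def by (rule tendsto_Lim[OF boundary_filter_nontrivial])
    then show "(f \<longlongrightarrow> g (\<xi> \<theta>, \<theta>)) (at (\<xi> \<theta>, \<theta>) within fluid_domain \<xi>)"
      using l g by simp
  qed
qed

text \<open>Lowering the surface by s > 0 keeps the deformation to a horizontal line inside the open
  fluid domain. On that line the slope is zero and only \<open>d_rho \<Phi>\<close> remains, which
  decays uniformly.\<close>

lemma interior_flux_zero:
  assumes \<xi>: "\<And>\<theta>. (\<xi> has_real_derivative deriv \<xi> \<theta>) (at \<theta>)" "continuous_on UNIV (deriv \<xi>)"
      "\<And>\<theta>. \<xi> (\<theta> + 2 * pi) = \<xi> \<theta>"
    and ext: "harmonic_extension \<xi> chi \<Phi>" and s: "0 < s"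
  shows "circle_integral (\<lambda>\<theta>. d_rho \<Phi> (\<xi> \<theta> - s, \<theta>) - deriv \<xi> \<theta> * d_theta \<Phi> (\<xi> \<theta> - s, \<theta>)) = 0"
    (is "?flux = 0")
proof -
  have cont: "continuous_on UNIV \<xi>"
    using \<xi>(1) by (auto intro: DERIV_isCont continuous_at_imp_continuous_on)
  note h = harmonic_extensionD(2)[OF ext]
  obtain C where C: "\<And>\<theta>. \<bar>\<xi> \<theta>\<bar> \<le> C"
    using periodic_bounded[OF \<xi>(3) continuous_on_subset[OF cont subset_UNIV]] by blast
  have "\<bar>?flux\<bar> \<le> e * (2 * pi)" if e: "0 < e" for e
  proof -
    have "\<forall>\<^sub>F \<rho> in at_bot. \<forall>\<theta>\<in>UNIV. dist (d_rho \<Phi> (\<rho>, \<theta>)) 0 < e"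
      using harmonic_extensionD(5)[OF ext] e by (rule uniform_limitD)
    then obtain R1 where R1: "\<And>\<rho> \<theta>. \<rho> \<le> R1 \<Longrightarrow> \<bar>d_rho \<Phi> (\<rho>, \<theta>)\<bar> < e"
      unfolding eventually_at_bot_linorder by auto
    \<comment> \<open>At most R1 for the decay, and not above any point of the lowered surface, so
      the vertical segments between the two curves stay in the fluid.\<close>
    define R where "R = min R1 (- C - s)"
    have R: "R \<le> \<xi> \<theta> - s" for \<theta>
      using C[of \<theta>] by (simp add: R_def abs_le_iff min_le_iff_disj)
    have inU: "(R + \<tau> * (\<xi> \<theta> - s - R), \<theta>) \<in> fluid_domain \<xi>" if "\<tau> \<le> 1" for \<tau> \<theta>
    proof -
      have "\<tau> * (\<xi> \<theta> - s - R) \<le> 1 * (\<xi> \<theta> - s - R)"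
        using R[of \<theta>] that by (intro mult_right_mono) auto
      then show ?thesis
        using s by (simp add: fluid_domain_def)
    qed
    have "circle_integral (\<lambda>\<theta>. d_rho \<Phi> (R, \<theta>) - 0 * d_theta \<Phi> (R, \<theta>)) =
      circle_integral (\<lambda>\<theta>. d_rho \<Phi> (R + (\<xi> \<theta> - s - R), \<theta>) - (0 + deriv \<xi> \<theta>) * d_theta \<Phi> (R + (\<xi> \<theta> - s - R), \<theta>))"
    proof (rule flux_homotopy_invariant[OF open_fluid_domain[OF cont] h])
      show "\<Phi> (\<rho>, \<theta> + 2 * pi) = \<Phi> (\<rho>, \<theta>)" for \<rho> \<theta>
        by (rule harmonic_extensionD(1)[OF ext])
      show "((\<lambda>\<theta>. \<xi> \<theta> - s - R) has_real_derivative deriv \<xi> \<theta>) (at \<theta>)" for \<theta>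
        using \<xi>(1) by (auto intro!: derivative_eq_intros)
      show "\<xi> (2 * pi) - s - R = \<xi> 0 - s - R"
        using \<xi>(3)[of 0] by simp
    qed (use inU \<xi>(2) in auto)
    then have "?flux = integral {0..2 * pi} (\<lambda>\<theta>. d_rho \<Phi> (R, \<theta>))"
      by (simp add: circle_integral_def)
    moreover have "norm (integral {0..2 * pi} (\<lambda>\<theta>. d_rho \<Phi> (R, \<theta>))) \<le> e * (2 * pi - 0)"
    proof (rule integral_bound)
      show "continuous_on {0..2 * pi} (\<lambda>\<theta>. d_rho \<Phi> (R, \<theta>))"
        using inU[of 0]
        by (intro continuous_on_compose2[OF C1_on_continuous_partials(1)[OF harmonic_onD(1)[OF h]]])
           (auto intro: continuous_on_Pair)
      show "norm (d_rho \<Phi> (R, \<theta>)) \<le> e" for \<theta>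
        using R1[of R \<theta>] by (simp add: R_def)
    qed simp
    ultimately show ?thesis
      by simp
  qed
  from this[of "e / (2 * pi)" for e] have "\<bar>?flux\<bar> \<le> 0 + e" if "0 < e" for e
    using that by simp
  then have "\<bar>?flux\<bar> \<le> 0"
    by (rule field_le_epsilon)
  then show ?thesis by simp
qed

text \<open>The flux densities \<open>f s\<close> on the lowered surfaces are jointly continuous in
  (s, \<theta>) down to s = 0, where they become \<open>DN \<xi> chi\<close>, so the zero integrals
  for s > 0 pass to the limit. Continuity of \<open>DN\<close> allows integrals against it to be
  split later.\<close>

lemma DN_continuous_mean_zero:
  assumes \<xi>: "\<And>\<theta>. (\<xi> has_real_derivative deriv \<xi> \<theta>) (at \<theta>)" "continuous_on UNIV (deriv \<xi>)"
    "\<And>\<theta>. \<xi> (\<theta> + 2 * pi) = \<xi> \<theta>"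
  shows "continuous_on UNIV (DN \<xi> chi)" "circle_integral (DN \<xi> chi) = 0"
proof -
  have "continuous_on UNIV (DN \<xi> chi) \<and> circle_integral (DN \<xi> chi) = 0"
  proof (cases "\<exists>\<Phi>. harmonic_extension \<xi> chi \<Phi>")
    case False
    then show ?thesis
      by (simp add: DN_def circle_integral_def)
  next
    case True
    then obtain \<Phi> where ext: "harmonic_extension \<xi> chi \<Phi>" ..
    have cont: "continuous_on UNIV \<xi>"
      using \<xi>(1) by (auto intro: DERIV_isCont continuous_at_imp_continuous_on)
    note partials = C1_on_continuous_partials[OF harmonic_onD(1)[OF harmonic_extensionD(2)[OF ext]]]
    obtain P where P: "continuous_on {p. fst p \<le> \<xi> (snd p)} P"
      "\<And>p. p \<in> fluid_domain \<xi> \<Longrightarrow> P p = d_rho \<Phi> p" "\<And>\<theta>. P (\<xi> \<theta>, \<theta>) = boundary_value \<xi> (d_rho \<Phi>) \<theta>"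
      using ext by (auto intro: boundary_value_continuous_extension[OF partials(1)] simp: harmonic_extension_def)
    obtain Q where Q: "continuous_on {p. fst p \<le> \<xi> (snd p)} Q"
      "\<And>p. p \<in> fluid_domain \<xi> \<Longrightarrow> Q p = d_theta \<Phi> p" "\<And>\<theta>. Q (\<xi> \<theta>, \<theta>) = boundary_value \<xi> (d_theta \<Phi>) \<theta>"
      using ext by (auto intro: boundary_value_continuous_extension[OF partials(2)] simp: harmonic_extension_def)
    define f where "f = (\<lambda>s \<theta>. P (\<xi> \<theta> - s, \<theta>) - deriv \<xi> \<theta> * Q (\<xi> \<theta> - s, \<theta>))"
    have DN: "DN \<xi> chi = f 0"
      unfolding DN_eq[OF cont \<xi>(3) ext] f_def by (simp add: P(3) Q(3))
    have shifted: "continuous_on ({0..} \<times> UNIV) (\<lambda>p. g (\<xi> (snd p) - fst p, snd p))"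
      if "continuous_on {p. fst p \<le> \<xi> (snd p)} g" for g :: "real \<times> real \<Rightarrow> real"
      by (rule continuous_on_compose2[OF that])
         (auto intro!: continuous_intros continuous_on_compose2[OF cont])
    have contf: "continuous_on ({0..} \<times> UNIV) (\<lambda>(s, \<theta>). f s \<theta>)"
      unfolding f_def split_beta'
      by (intro continuous_on_diff continuous_on_mult shifted P(1) Q(1) continuous_on_compose2[OF \<xi>(2)])
         (auto intro: continuous_on_snd)
    have "continuous_on UNIV (f 0)"
      using continuous_on_compose2[OF contf continuous_on_Pair[OF continuous_on_const continuous_on_id], of 0 UNIV]
      by (simp add: image_subset_iff)
    moreover have "integral (cbox 0 (2 * pi)) (f 0) = 0"
    proof (rule continuous_constant_on_closure[where f = "\<lambda>s. integral (cbox 0 (2 * pi)) (f s)" and S = "{0<..1}" and x = 0])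
      have "continuous_on {0..1} (\<lambda>s. integral (cbox 0 (2 * pi)) (f s))"
        by (rule integral_continuous_on_param) (auto intro: continuous_on_subset[OF contf])
      then show "continuous_on (closure {0<..1}) (\<lambda>s. integral (cbox 0 (2 * pi)) (f s))"
        by simp
      show "integral (cbox 0 (2 * pi)) (f s) = 0" if "s \<in> {0<..1}" for s
      proof -
        have "f s = (\<lambda>\<theta>. d_rho \<Phi> (\<xi> \<theta> - s, \<theta>) - deriv \<xi> \<theta> * d_theta \<Phi> (\<xi> \<theta> - s, \<theta>))"
          using that by (simp add: f_def P(2) Q(2) fluid_domain_def)
        then show ?thesis
          using interior_flux_zero[OF \<xi> ext, of s] that by (simp add: circle_integral_def)
      qed
    qed simp
    ultimately show ?thesis
      by (simp add: DN circle_integral_def)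
  qed
  then show "continuous_on UNIV (DN \<xi> chi)" "circle_integral (DN \<xi> chi) = 0"
    by simp_all
qed

section \<open>Invariance of the Hamiltonian\<close>

text \<open>Since \<open>DN\<close> ignores the added constant, the kinetic term changes only by a/2
  times the total flux.\<close>

lemma hamiltonian_add_const:
  assumes "1 \<le> k" "(\<xi>, chi) \<in> phase_space k"
  shows "hamiltonian \<sigma>\<^sub>0 (\<xi>, \<lambda>\<theta>. chi \<theta> + a) = hamiltonian \<sigma>\<^sub>0 (\<xi>, chi)"
proof -
  have C: "\<xi> \<in> Ck_circle k" "chi \<in> Ck_circle k"
    using assms(2) by (auto simp: phase_space_def)
  note \<xi> = Ck_circle_C1[OF C(1) assms(1)] Ck_circle_periodic[OF C(1)]
  note DN = DN_continuous_mean_zero[OF \<xi>]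
  have "circle_integral (\<lambda>\<theta>. (chi \<theta> + a) * DN \<xi> chi \<theta>) =
      circle_integral (\<lambda>\<theta>. chi \<theta> * DN \<xi> chi \<theta>) + circle_integral (\<lambda>\<theta>. a * DN \<xi> chi \<theta>)"
    unfolding circle_integral_def distrib_right
    by (intro Henstock_Kurzweil_Integration.integral_add integrable_continuous_real continuous_on_mult
        continuous_on_const Ck_circle_continuous[OF C(2)] continuous_on_subset[OF DN(1)]) auto
  also have "circle_integral (\<lambda>\<theta>. a * DN \<xi> chi \<theta>) = 0"
    using DN(2) by (simp add: circle_integral_def)
  finally show ?thesis
    by (simp add: hamiltonian_def DN_add_const[OF Ck_circle_continuous[OF C(1)] \<xi>(3)])
qed

text \<open>The equivalence for \<open>has_gradient\<close> says that a gradient exists at u exactly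
  when it exists at the shifted state; the equation for \<open>gradient\<close> alone could hold
  through the default 0. Conservation appears both along solutions on an arbitrary interval and as
  the bracket identity.\<close>

theorem lemma3p6:
  fixes \<sigma>\<^sub>0 :: real and k :: enat
  assumes "2 \<le> k"
  shows
    "(\<forall>u\<in>phase_space k.
        shift 0 u = u \<and> (\<forall>a b. shift (a + b) u = shift a (shift b u))
        \<and> has_Ck_state_derivative k (\<lambda>a. shift a u) (\<lambda>_. 0, \<lambda>_. 1) 0 UNIV)
   \<and> (\<forall>u\<in>phase_space k. \<forall>a.
        hamiltonian \<sigma>\<^sub>0 (shift a u) = hamiltonian \<sigma>\<^sub>0 u
        \<and> (\<forall>g. has_gradient k (hamiltonian \<sigma>\<^sub>0) (shift a u) g \<longleftrightarrow> has_gradient k (hamiltonian \<sigma>\<^sub>0) u g)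
        \<and> gradient k (hamiltonian \<sigma>\<^sub>0) (shift a u) = gradient k (hamiltonian \<sigma>\<^sub>0) u)
   \<and> (\<forall>(\<xi>, chi)\<in>phase_space k.
        has_gradient k mass (\<xi>, chi) (\<lambda>\<theta>. exp (2 * \<xi> \<theta>), \<lambda>_. 0)
        \<and> gradient k mass (\<xi>, chi) = (\<lambda>\<theta>. exp (2 * \<xi> \<theta>), \<lambda>_. 0))
   \<and> (\<forall>I u. is_interval I \<longrightarrow> solves_system k (hamiltonian \<sigma>\<^sub>0) I u \<longrightarrow>
        (\<forall>s\<in>I. \<forall>t\<in>I. mass (u s) = mass (u t)))
   \<and> (\<forall>u\<in>phase_space k. poisson k mass (hamiltonian \<sigma>\<^sub>0) u = 0)
   \<and> (\<forall>u\<in>phase_space k. \<forall>a \<alpha>.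
        mass (shift a u) = mass u
        \<and> mass (translate \<alpha> u) = mass u
        \<and> gradient k mass (shift a u) = gradient k mass u
        \<and> gradient k mass (translate \<alpha> u) = translate \<alpha> (gradient k mass u))"
proof -
  have "1 \<le> k"
    using assms by (rule order_trans[rotated]) simp
  note inv = hamiltonian_add_const[OF this]
  have group: "has_Ck_state_derivative k (\<lambda>a. shift a u) (\<lambda>_. 0, \<lambda>_. 1) 0 UNIV"
    "shift 0 u = u" "shift (a + b) u = shift a (shift b u)" for u a b
    by (rule shift_has_Ck_state_derivative) (simp_all add: shift_def split_beta algebra_simps)
  have ham: "hamiltonian \<sigma>\<^sub>0 (shift a u) = hamiltonian \<sigma>\<^sub>0 u"
    "has_gradient k (hamiltonian \<sigma>\<^sub>0) (shift a u) g \<longleftrightarrow> has_gradient k (hamiltonian \<sigma>\<^sub>0) u g"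
    "gradient k (hamiltonian \<sigma>\<^sub>0) (shift a u) = gradient k (hamiltonian \<sigma>\<^sub>0) u"
    if "u \<in> phase_space k" for u a g
  proof -
    obtain \<xi> chi where u: "u = (\<xi>, chi)"
      by (cases u)
    note grads = has_L2_grad_shift[where A = "hamiltonian \<sigma>\<^sub>0" and a = a, OF inv that[unfolded u]]
    show "hamiltonian \<sigma>\<^sub>0 (shift a u) = hamiltonian \<sigma>\<^sub>0 u"
      using inv that by (simp add: u shift_def)
    show "has_gradient k (hamiltonian \<sigma>\<^sub>0) (shift a u) g \<longleftrightarrow> has_gradient k (hamiltonian \<sigma>\<^sub>0) u g"
      using grads by (simp add: u shift_def has_gradient_def)
    show "gradient k (hamiltonian \<sigma>\<^sub>0) (shift a u) = gradient k (hamiltonian \<sigma>\<^sub>0) u"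
      using grads[THEN L2_grad_cong] by (simp add: u shift_def gradient_def grad_xi_def grad_chi_def)
  qed
  have grad_mass: "has_gradient k mass (\<xi>, chi) (\<lambda>\<theta>. exp (2 * \<xi> \<theta>), \<lambda>_. 0)"
    "gradient k mass (\<xi>, chi) = (\<lambda>\<theta>. exp (2 * \<xi> \<theta>), \<lambda>_. 0)"
    if "(\<xi>, chi) \<in> phase_space k" for \<xi> chi
    using that mass_has_gradient gradient_eq[OF mass_has_gradient] by (auto simp: phase_space_def)
  then have grad_mass_all: "\<forall>(\<xi>, chi)\<in>phase_space k.
      has_gradient k mass (\<xi>, chi) (\<lambda>\<theta>. exp (2 * \<xi> \<theta>), \<lambda>_. 0)
      \<and> gradient k mass (\<xi>, chi) = (\<lambda>\<theta>. exp (2 * \<xi> \<theta>), \<lambda>_. 0)"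
    by blast
  have conserved: "mass (u s) = mass (u t)"
    if "is_interval I" "solves_system k (hamiltonian \<sigma>\<^sub>0) I u" "s \<in> I" "t \<in> I" for I u s t
    using inv that by (rule mass_conserved)
  have poisson: "poisson k mass (hamiltonian \<sigma>\<^sub>0) u = 0" if "u \<in> phase_space k" for u
    using that inv by (cases u) (auto intro: poisson_mass simp: phase_space_def)
  have mass: "mass (shift a u) = mass u" "mass (translate \<alpha> u) = mass u"
    "gradient k mass (shift a u) = gradient k mass u"
    "gradient k mass (translate \<alpha> u) = translate \<alpha> (gradient k mass u)"
    if "u \<in> phase_space k" for u a \<alpha>
  proof -
    obtain \<xi> chi where u: "u = (\<xi>, chi)"
      by (cases u)
    have C: "\<xi> \<in> Ck_circle k" "chi \<in> Ck_circle k"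
      using that by (auto simp: u phase_space_def)
    show "mass (shift a u) = mass u" "mass (translate \<alpha> u) = mass u"
      using C by (simp_all add: u mass_translate) (simp add: mass_def shift_def)
    \<comment> \<open>Shifted and translated states lie in the phase space again, so the explicit
      formula for the gradient evaluates both sides.\<close>
    show "gradient k mass (shift a u) = gradient k mass u"
      "gradient k mass (translate \<alpha> u) = translate \<alpha> (gradient k mass u)"
      using shift_phase_space[OF that, of a] C
      by (simp_all add: u shift_def translate_def grad_mass phase_space_def Ck_circle_translate)
  qed
  show ?thesis
    by (intro conjI ballI allI impI) (rule group ham grad_mass_all[THEN bspec] conserved poisson mass | assumption)+
qed

end
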